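(* Let $\mathsf k$ be a field of characteristic zero and let $G$ be a finite group acting linearly on $\mathsf k[x_1,\ldots,x_n]$. If the quotient variety $\mathbb A^n(\mathsf k)/G$ is rational (equivalently, the field of invariants $\mathsf k(x_1,\ldots,x_n)^G$ is a purely transcendental extension of $\mathsf k$), then the Noncommutative Noether's Problem has a positive solution for $G$, that is, $F_n(\mathsf k)^G\cong F_n(\mathsf k)$ as $\mathsf k$-algebras.
   Context: $A_n(\mathsf k)$ is the $n$-th Weyl algebra: the unital associative $\mathsf k$-algebra generated by $x_1,\dots,x_n,\partial_1,\dots,\partial_n$ with $\partial_i x_j-x_j\partial_i=\delta_{ij}$, $x_ix_j=x_jx_i$, $\partial_i\partial_j=\partial_j\partial_i$; it is the ring of differential operators on $\mathsf k[x_1,\dots,x_n]$. It is an Ore domain and $F_n(\mathsf k)$ denotes its skew field of fractions. A linear action of $G$ on $\mathsf k[x_1,\ldots,x_n]$ is an action by $\mathsf k$-algebra automorphisms preserving the span of $x_1,\dots,x_n$. It extends to $\mathsf k(x_1,\dots,x_n)$; it extends to $A_n(\mathsf k)$ by $g*d=g\circ d\circ g^{-1}$, and then uniquely to $F_n(\mathsf k)$. The variety $\mathbb A^n(\mathsf k)/G$ is rational if it is birational to $\mathbb A^m(\mathsf k)$ for some $m$. The Noncommutative Noether's Problem asks whether $F_n(\mathsf k)^G\cong F_m(L)$ for some $m$ and some purely transcendental extension $L$ of $\mathsf k$; it is known that such an isomorphism forces $m=n$ and $L=\mathsf k$, so a positive solution means $F_n(\mathsf k)^G\cong F_n(\mathsf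 k)$. *)

theory Defs
  imports
    "HOL-Algebra.Algebraic_Closure_Type"
    "HOL-Algebra.Generated_Fields"
    "HOL-Algebra.Group_Action"
    "HOL-Library.Poly_Mapping"
    "HOL-Computational_Algebra.Polynomial_Factorial"
begin

section \<open>Polynomials and rational functions in several variables\<close>

text \<open>A polynomial maps exponent vectors to coefficients. For a finite index type \<open>'n\<close> the type
  \<open>('n, 'k) mpoly\<close> is the polynomial ring in \<open>n = CARD('n)\<close> variables. A linear order on \<open>'n\<close> is
  required only because the library derives the absence of zero divisors from it.\<close>

type_synonym ('v, 'k) mpoly = "('v \<Rightarrow>\<^sub>0 nat) \<Rightarrow>\<^sub>0 'k"

type_synonym ('v, 'k) ratfun = "('v, 'k) mpoly fract"

definition Const :: "'k \<Rightarrow> ('v, 'k::comm_ring_1) mpoly" where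
  "Const c = Poly_Mapping.single 0 c"

definition Var :: "'v \<Rightarrow> ('v, 'k::comm_ring_1) mpoly" where
  "Var i = Poly_Mapping.single (Poly_Mapping.single i 1) 1"

definition partial :: "'v \<Rightarrow> ('v, 'k::comm_ring_1) mpoly \<Rightarrow> ('v, 'k) mpoly" where
  "partial i p = (\<Sum>m\<in>Poly_Mapping.keys p.
     Poly_Mapping.single (m - Poly_Mapping.single i 1)
       (of_nat (Poly_Mapping.lookup m i) * Poly_Mapping.lookup p m))"

definition linear_forms :: "('n::finite, 'k::comm_ring_1) mpoly set" where
  "linear_forms = {\<Sum>i\<in>UNIV. Const (c i) * Var i | c. True}"

definition ratfun_const :: "'k \<Rightarrow> ('n::linorder, 'k::idom) ratfun" where
  "ratfun_const c = to_fract (Const c)"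


section \<open>Purely transcendental extensions\<close>

text \<open>A field extension of \<open>'k\<close> is a field \<open>'a\<close> with the embedding \<open>s :: 'k \<Rightarrow> 'a\<close>.\<close>

definition poly_eval :: "('k::comm_ring_1 \<Rightarrow> 'a::comm_ring_1) \<Rightarrow> ('v \<Rightarrow> 'a) \<Rightarrow> ('v, 'k) mpoly \<Rightarrow> 'a" where
  "poly_eval s y p = (\<Sum>m\<in>Poly_Mapping.keys p.
     s (Poly_Mapping.lookup p m) * (\<Prod>i\<in>Poly_Mapping.keys m. y i ^ Poly_Mapping.lookup m i))"

text \<open>The variables of the relation \<open>p\<close> are indexed by the elements of \<open>B\<close> themselves.\<close>

definition algebraically_independent :: "('k::field \<Rightarrow> 'a::field) \<Rightarrow> 'a set \<Rightarrow> bool" where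
  "algebraically_independent s B \<longleftrightarrow>
     (\<forall>p :: ('a, 'k) mpoly. (\<forall>m\<in>Poly_Mapping.keys p. Poly_Mapping.keys m \<subseteq> B) \<longrightarrow>
        poly_eval s (\<lambda>b. b) p = 0 \<longrightarrow> p = 0)"

definition purely_transcendental :: "('k::field \<Rightarrow> 'a::field) \<Rightarrow> 'a set \<Rightarrow> bool" where
  "purely_transcendental s K \<longleftrightarrow>
     (\<exists>B. algebraically_independent s B \<and>
          K = generate_field ring_of_type_algebra (range s \<union> B))"


section \<open>Linear actions\<close>

definition poly_algebra_automorphism :: "(('n, 'k::comm_ring_1) mpoly \<Rightarrow> ('n, 'k) mpoly) \<Rightarrow> bool" where
  "poly_algebra_automorphism f \<longleftrightarrow> bij f \<and>
     (\<forall>p q. f (p + q) = f p + f q) \<and> (\<forall>p q. f (p * q) = f p * f q) \<and>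
     (\<forall>c. f (Const c) = Const c)"

definition linear_action ::
  "('g, 'm) monoid_scheme \<Rightarrow> ('g \<Rightarrow> ('n::finite, 'k::comm_ring_1) mpoly \<Rightarrow> ('n, 'k) mpoly) \<Rightarrow> bool" where
  "linear_action G \<phi> \<longleftrightarrow> group_action G UNIV \<phi> \<and>
     (\<forall>g\<in>carrier G. poly_algebra_automorphism (\<phi> g) \<and> \<phi> g ` linear_forms \<subseteq> linear_forms)"


section \<open>The Weyl algebra\<close>

text \<open>In characteristic zero the algebra with generators \<open>x\<^sub>i\<close>, \<open>\<partial>\<^sub>i\<close> and the Weyl relations acts
  faithfully on the polynomial ring; it is realised here as its image, the algebra of differential
  operators generated by the multiplications by \<open>x\<^sub>i\<close> and the partial derivatives. The sum of
  operators is pointwise and their product is \<open>\<circ>\<close>.\<close>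

type_synonym ('n, 'k) operator = "('n, 'k) mpoly \<Rightarrow> ('n, 'k) mpoly"

inductive_set weyl_algebra :: "('n, 'k::comm_ring_1) operator set" where
  scalar: "(\<lambda>p. Const c * p) \<in> weyl_algebra"
| var: "(\<lambda>p. Var i * p) \<in> weyl_algebra"
| partial: "partial i \<in> weyl_algebra"
| add: "d \<in> weyl_algebra \<Longrightarrow> e \<in> weyl_algebra \<Longrightarrow> (\<lambda>p. d p + e p) \<in> weyl_algebra"
| mult: "d \<in> weyl_algebra \<Longrightarrow> e \<in> weyl_algebra \<Longrightarrow> d \<circ> e \<in> weyl_algebra"

definition weyl_action ::
  "('g, 'm) monoid_scheme \<Rightarrow> ('g \<Rightarrow> ('n, 'k) operator) \<Rightarrow> 'g \<Rightarrow>
     ('n, 'k::comm_ring_1) operator \<Rightarrow> ('n, 'k) operator" where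
  "weyl_action G \<phi> g d = \<phi> g \<circ> d \<circ> \<phi> (inv\<^bsub>G\<^esub> g)"

text \<open>The division ring \<open>'f\<close> is, via \<open>\<iota>\<close>, a skew field of fractions of the Weyl algebra: \<open>\<iota>\<close> is an
  embedding of unital rings (only its values on \<^const>\<open>weyl_algebra\<close> matter) and every element of \<open>'f\<close>
  is a right fraction. As the Weyl algebra is an Ore domain, such a pair exists, is unique up to a
  unique isomorphism, and left fractions give the same notion.\<close>

definition weyl_skew_field :: "(('n, 'k::comm_ring_1) operator \<Rightarrow> 'f::division_ring) \<Rightarrow> bool" where
  "weyl_skew_field \<iota> \<longleftrightarrow> inj_on \<iota> weyl_algebra \<and> \<iota> id = 1 \<and>
     (\<forall>d\<in>weyl_algebra. \<forall>e\<in>weyl_algebra. \<iota> (\<lambda>p. d p + e p) = \<iota> d + \<iota> e \<and> \<iota> (d \<circ> e) = \<iota> d * \<iota> e) \<and>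
     (\<forall>f. \<exists>a\<in>weyl_algebra. \<exists>b\<in>weyl_algebra. b \<noteq> (\<lambda>_. 0) \<and> f = \<iota> a * inverse (\<iota> b))"

definition weyl_const :: "(('n, 'k::comm_ring_1) operator \<Rightarrow> 'f) \<Rightarrow> 'k \<Rightarrow> 'f" where
  "weyl_const \<iota> c = \<iota> (\<lambda>p. Const c * p)"


section \<open>Extension of the action to fractions, and invariants\<close>

definition ring_automorphism :: "('a::ring_1 \<Rightarrow> 'a) \<Rightarrow> bool" where
  "ring_automorphism \<sigma> \<longleftrightarrow> bij \<sigma> \<and>
     (\<forall>x y. \<sigma> (x + y) = \<sigma> x + \<sigma> y) \<and> (\<forall>x y. \<sigma> (x * y) = \<sigma> x * \<sigma> y)"

text \<open>The unique automorphism of the (skew) field of fractions, into which the domain \<open>A\<close> is embedded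
  by \<open>\<iota>\<close>, that extends the automorphism \<open>f\<close> of \<open>A\<close>.\<close>

definition fraction_extension :: "('r \<Rightarrow> 'a::division_ring) \<Rightarrow> 'r set \<Rightarrow> ('r \<Rightarrow> 'r) \<Rightarrow> 'a \<Rightarrow> 'a" where
  "fraction_extension \<iota> A f = (THE \<sigma>. ring_automorphism \<sigma> \<and> (\<forall>a\<in>A. \<sigma> (\<iota> a) = \<iota> (f a)))"

definition ratfun_invariants ::
  "('g, 'm) monoid_scheme \<Rightarrow> ('g \<Rightarrow> ('n::linorder, 'k::idom) operator) \<Rightarrow> ('n, 'k) ratfun set" where
  "ratfun_invariants G \<phi> =
     {q. \<forall>g\<in>carrier G. fraction_extension to_fract UNIV (\<phi> g) q = q}"

definition weyl_field_invariants ::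
  "('g, 'm) monoid_scheme \<Rightarrow> ('g \<Rightarrow> ('n, 'k::comm_ring_1) operator) \<Rightarrow>
     (('n, 'k) operator \<Rightarrow> 'f::division_ring) \<Rightarrow> 'f set" where
  "weyl_field_invariants G \<phi> \<iota> =
     {f. \<forall>g\<in>carrier G. fraction_extension \<iota> weyl_algebra (weyl_action G \<phi> g) f = f}"

text \<open>Isomorphism of the subalgebras \<open>K\<close> and \<open>L\<close> of two \<open>'k\<close>-algebras with structure maps \<open>s\<close> and \<open>t\<close>;
  it preserves the unit because it preserves scalars.\<close>

definition algebras_isomorphic ::
  "('k \<Rightarrow> 'a::ring_1) \<Rightarrow> 'a set \<Rightarrow> ('k \<Rightarrow> 'b::ring_1) \<Rightarrow> 'b set \<Rightarrow> bool" where
  "algebras_isomorphic s K t L \<longleftrightarrow>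
     (\<exists>h. bij_betw h K L \<and>
       (\<forall>x\<in>K. \<forall>y\<in>K. h (x + y) = h x + h y \<and> h (x * y) = h x * h y) \<and>
       (\<forall>c. h (s c) = t c))"


section \<open>The Weyl relations\<close>

lemma lookup_partial:
  "Poly_Mapping.lookup (partial i p) m =
     of_nat (Suc (Poly_Mapping.lookup m i)) * Poly_Mapping.lookup p (m + Poly_Mapping.single i 1)"
proof -
  let ?e = "Poly_Mapping.single i (1::nat)"
  have shift: "k = m + ?e" if "k - ?e = m" "Poly_Mapping.lookup k i \<noteq> 0" for k
  proof (rule poly_mapping_eqI)
    fix j
    have "Poly_Mapping.lookup m j = Poly_Mapping.lookup k j - Poly_Mapping.lookup ?e j"
      using that(1) by (metis lookup_minus)
    then show "Poly_Mapping.lookup k j = Poly_Mapping.lookup (m + ?e) j"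
      using that(2) by (cases "i = j") (auto simp: lookup_add lookup_single)
  qed
  have "Poly_Mapping.lookup (partial i p) m = (\<Sum>k\<in>Poly_Mapping.keys p.
      (of_nat (Poly_Mapping.lookup k i) * Poly_Mapping.lookup p k when k - ?e = m))"
    unfolding partial_def by (simp add: lookup_sum lookup_single)
  also have "\<dots> = (\<Sum>k\<in>Poly_Mapping.keys p.
      (if k = m + ?e then of_nat (Suc (Poly_Mapping.lookup m i)) * Poly_Mapping.lookup p k else 0))"
  proof (rule sum.cong[OF refl])
    fix k
    show "(of_nat (Poly_Mapping.lookup k i) * Poly_Mapping.lookup p k when k - ?e = m) =
      (if k = m + ?e then of_nat (Suc (Poly_Mapping.lookup m i)) * Poly_Mapping.lookup p k else 0)"
    proof (cases "k = m + ?e")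
      case True
      then show ?thesis by (simp add: lookup_add lookup_single)
    next
      case False
      then have "k - ?e \<noteq> m \<or> Poly_Mapping.lookup k i = 0"
        using shift by blast
      with False show ?thesis by (elim disjE) (simp_all del: One_nat_def)
    qed
  qed
  also have "\<dots> = of_nat (Suc (Poly_Mapping.lookup m i)) * Poly_Mapping.lookup p (m + ?e)"
    by (auto simp: sum.delta in_keys_iff)
  finally show ?thesis .
qed

lemma lookup_Var_mult:
  "Poly_Mapping.lookup (Var j * p) m =
     (if Poly_Mapping.lookup m j = 0 then 0 else Poly_Mapping.lookup p (m - Poly_Mapping.single j 1))"
proof -
  let ?e = "Poly_Mapping.single j (1::nat)"
  have split: "m = ?e + q \<longleftrightarrow> Poly_Mapping.lookup m j \<noteq> 0 \<and> q = m - ?e" for q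
  proof
    assume "Poly_Mapping.lookup m j \<noteq> 0 \<and> q = m - ?e"
    then show "m = ?e + q"
      by (intro poly_mapping_eqI) (auto simp: lookup_add lookup_minus lookup_single when_def)
  qed (auto simp: lookup_add lookup_single)
  have "Poly_Mapping.lookup (Var j * p) m =
     Sum_any (\<lambda>l. (1 when ?e = l) * Sum_any (\<lambda>q. Poly_Mapping.lookup p q when m = l + q))"
    by (simp add: Var_def lookup_mult lookup_single)
  also have "\<dots> = Sum_any (\<lambda>l. Sum_any (\<lambda>q. Poly_Mapping.lookup p q when m = ?e + q) when ?e = l)"
    by (rule Sum_any.cong) (simp add: when_def)
  also have "\<dots> = Sum_any (\<lambda>q. Poly_Mapping.lookup p q when m = ?e + q)"
    by simp
  also have "\<dots> = (if Poly_Mapping.lookup m j = 0 then 0 else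
      Sum_any (\<lambda>q. Poly_Mapping.lookup p q when q = m - ?e))"
    unfolding split by simp
  finally show ?thesis by simp
qed

lemma partial_Var_commutator:
  "partial i (Var j * p) - Var j * partial i p = (if i = j then p else 0)"
proof (rule poly_mapping_eqI)
  fix m
  let ?i = "Poly_Mapping.single i (1::nat)" and ?j = "Poly_Mapping.single j (1::nat)"
  have "m + ?i - ?j = m - ?j + ?i" if "i \<noteq> j \<or> Poly_Mapping.lookup m j \<noteq> 0"
    using that by (intro poly_mapping_eqI) (auto simp: lookup_add lookup_minus lookup_single when_def)
  then show "Poly_Mapping.lookup (partial i (Var j * p) - Var j * partial i p) m =
      Poly_Mapping.lookup (if i = j then p else 0) m"
    by (auto simp: lookup_minus lookup_partial lookup_Var_mult lookup_add lookup_single when_def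
        distrib_right)
qed

lemma partial_commute: "partial i (partial j p) = partial j (partial i p)"
  by (rule poly_mapping_eqI)
    (simp add: lookup_partial lookup_add lookup_single when_def ac_simps)

end

theory Submission
  imports Defs
begin

text \<open>Let \<open>K = k(x\<^sub>1, \<dots>, x\<^sub>n)\<close> and let \<open>L = K\<^sup>G\<close> have the transcendence basis \<open>B\<close>. By Artin's lemma \<open>K\<close>
  is finite over \<open>L\<close>, so in characteristic zero a derivation of \<open>K\<close> that vanishes on \<open>B\<close> is zero.
  Together with the bound on the number of algebraically independent elements this gives \<open>B = {y\<^sub>1, \<dots>, y\<^sub>n}\<close>
  with an invertible Jacobian matrix, hence derivations \<open>\<Delta>\<^sub>i\<close> of \<open>K\<close> that are combinations of the
  \<open>\<partial>\<^sub>j\<close> with coefficients in \<open>K\<close> and satisfy \<open>\<Delta>\<^sub>i y\<^sub>j = \<delta>\<^sub>i\<^sub>j\<close>. Being determined by these values, they commute and are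
  \<open>G\<close>-invariant. Thus \<open>x\<^sub>i \<mapsto> y\<^sub>i\<close>, \<open>\<partial>\<^sub>i \<mapsto> \<Delta>\<^sub>i\<close> defines an embedding \<open>\<Psi>\<close> of the skew field \<open>F\<close> into \<open>F\<^sup>G\<close>,
  whose range contains \<open>L\<close>. Since \<open>K\<close> is finite over \<open>L\<close>, \<open>F\<close> is a finite-dimensional right vector space
  over the range of \<open>\<Psi>\<close>, spanned by elements of \<open>K\<close>, and averaging over \<open>G\<close> shows that every
  invariant lies in that range.\<close>

section \<open>Linear systems over division rings\<close>

text \<open>Two obstacles shape the proof. The Weyl algebra is given as a set of operators and not
  by a presentation, so prescribing images of generators does not yet define a map. The map is built
  as a graph on normal forms \<open>\<Sum> p * mon M\<close>; uniqueness of such forms on both sides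
  makes the graph single-valued and injective. Secondly, \<open>\<Psi>\<close> is an endomorphism of
  a division ring with no inverse in sight. That its range is large enough is a matter of dimension:
  the span contains 1 and is stable under left multiplication by the Weyl algebra, so it contains
  that algebra, and finite dimension then supplies the inverses of denominators. One principle
  carries every dimension count, namely that a homogeneous system with more unknowns than equations
  has a nonzero solution: the bound on independent elements, Artin's lemma, the lower bound for the
  size of \<open>B\<close>, the inverse Jacobian and the inverses in the span. Coefficients stand on
  the left and unknowns on the right because the last count takes place in the noncommutative
  \<open>'f\<close>.\<close>

lemma homogeneous_system_nontrivial_solution:
  fixes a :: "'j \<Rightarrow> 'i \<Rightarrow> 'a::division_ring"
  assumes "finite J" and "finite I" and "card J < card I"
  shows "\<exists>c. (\<exists>i\<in>I. c i \<noteq> 0) \<and> (\<forall>j\<in>J. (\<Sum>i\<in>I. a j i * c i) = 0)"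
  using assms
proof (induction J arbitrary: I a rule: finite_induct)
  case empty
  then obtain i where "i \<in> I" by fastforce
  then show ?case by (intro exI[of _ "\<lambda>_. 1"]) auto
next
  case (insert j J)
  show ?case
  proof (cases "\<forall>i\<in>I. a j i = 0")
    case True
    obtain c where "\<exists>i\<in>I. c i \<noteq> 0" "\<forall>k\<in>J. (\<Sum>i\<in>I. a k i * c i) = 0"
      using insert.IH[of I a] insert.prems insert.hyps by auto
    with True show ?thesis by (intro exI[of _ c]) auto
  next
    case False
    then obtain i0 where i0: "i0 \<in> I" "a j i0 \<noteq> 0" by blast
    \<comment> \<open>Equation \<open>j\<close> is solved for the unknown \<open>i0\<close>;
      \<open>a'\<close> holds the coefficients of the remaining equations after this substitution.
      The order of the factors respects noncommutativity.\<close>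
    define a' where "a' = (\<lambda>k i. a k i - a k i0 * (inverse (a j i0) * a j i))"
    obtain c where c: "\<exists>i\<in>I - {i0}. c i \<noteq> 0" "\<forall>k\<in>J. (\<Sum>i\<in>I - {i0}. a' k i * c i) = 0"
      using insert.IH[of "I - {i0}" a'] insert.prems insert.hyps i0 by (auto simp: less_diff_conv)
    define s where "s = (\<Sum>i\<in>I - {i0}. a j i * c i)"
    define d where "d = c(i0 := - (inverse (a j i0) * s))"
    have split: "(\<Sum>i\<in>I. a k i * d i) = (\<Sum>i\<in>I - {i0}. a k i * c i) - a k i0 * (inverse (a j i0) * s)"
      for k
    proof -
      have "(\<Sum>i\<in>I. a k i * d i) = a k i0 * d i0 + (\<Sum>i\<in>I - {i0}. a k i * d i)"
        using i0 insert.prems by (simp add: sum.remove)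
      also have "(\<Sum>i\<in>I - {i0}. a k i * d i) = (\<Sum>i\<in>I - {i0}. a k i * c i)"
        by (rule sum.cong) (auto simp: d_def)
      finally show ?thesis by (simp add: d_def)
    qed
    have "(\<Sum>i\<in>I. a k i * d i) = 0" if "k \<in> J" for k
    proof -
      have "(\<Sum>i\<in>I - {i0}. a' k i * c i) =
          (\<Sum>i\<in>I - {i0}. a k i * c i) - a k i0 * (inverse (a j i0) * s)"
        by (simp add: a'_def s_def left_diff_distrib sum_subtractf sum_distrib_left mult.assoc)
      then show ?thesis using c(2) that split by metis
    qed
    moreover have "(\<Sum>i\<in>I. a j i * d i) = 0"
      unfolding split using i0 by (simp add: mult.assoc[symmetric] s_def)
    moreover have "\<exists>i\<in>I. d i \<noteq> 0" using c(1) by (auto simp: d_def)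
    ultimately show ?thesis by blast
  qed
qed


section \<open>Subrings and extension of homomorphisms to fractions\<close>

text \<open>Homomorphisms are relative to a set because the Weyl algebra occurs inside
  \<open>'f\<close> only as a subset.\<close>

definition ring_hom_on :: "'a::ring_1 set \<Rightarrow> ('a \<Rightarrow> 'b::ring_1) \<Rightarrow> bool" where
  "ring_hom_on S f \<longleftrightarrow>
     f 1 = 1 \<and> (\<forall>x\<in>S. \<forall>y\<in>S. f (x + y) = f x + f y \<and> f (x * y) = f x * f y)"

definition unital_subring :: "'a::ring_1 set \<Rightarrow> bool" where
  "unital_subring S \<longleftrightarrow> 1 \<in> S \<and> (\<forall>x\<in>S. \<forall>y\<in>S. x - y \<in> S \<and> x * y \<in> S)"

definition division_subring :: "'a::division_ring set \<Rightarrow> bool" where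
  "division_subring S \<longleftrightarrow> unital_subring S \<and> (\<forall>x\<in>S. inverse x \<in> S)"

lemma ring_hom_onD:
  assumes "ring_hom_on S f"
  shows "f 1 = 1"
    and "x \<in> S \<Longrightarrow> y \<in> S \<Longrightarrow> f (x + y) = f x + f y"
    and "x \<in> S \<Longrightarrow> y \<in> S \<Longrightarrow> f (x * y) = f x * f y"
  using assms by (auto simp: ring_hom_on_def)

lemma unital_subringD:
  assumes "unital_subring S"
  shows "1 \<in> S" and "0 \<in> S"
    and "x \<in> S \<Longrightarrow> y \<in> S \<Longrightarrow> x - y \<in> S"
    and "x \<in> S \<Longrightarrow> - x \<in> S"
    and "x \<in> S \<Longrightarrow> y \<in> S \<Longrightarrow> x + y \<in> S"
    and "x \<in> S \<Longrightarrow> y \<in> S \<Longrightarrow> x * y \<in> S"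
proof -
  show one: "1 \<in> S" and diff: "\<And>x y. x \<in> S \<Longrightarrow> y \<in> S \<Longrightarrow> x - y \<in> S"
    and "x \<in> S \<Longrightarrow> y \<in> S \<Longrightarrow> x * y \<in> S"
    using assms by (auto simp: unital_subring_def)
  show zero: "0 \<in> S" using diff[OF one one] by simp
  show neg: "- x \<in> S" if "x \<in> S" for x using diff[OF zero that] by simp
  show "x + y \<in> S" if "x \<in> S" "y \<in> S" using diff[OF that(1) neg[OF that(2)]] by simp
qed

lemma unital_subring_sum:
  assumes "unital_subring S" and "\<And>i. i \<in> I \<Longrightarrow> f i \<in> S"
  shows "sum f I \<in> S"
  using assms(2)
  by (induction I rule: infinite_finite_induct) (auto intro: unital_subringD[OF assms(1)])

lemma unital_subring_of_nat: "unital_subring S \<Longrightarrow> of_nat n \<in> S"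
  by (induction n) (auto intro: unital_subringD)

lemma unital_subring_UNIV [simp]: "unital_subring UNIV"
  by (simp add: unital_subring_def)

lemma ring_hom_on_zero:
  assumes "ring_hom_on S f" and "unital_subring S"
  shows "f 0 = 0"
proof -
  have "f (0 + 0) = f 0 + f 0"
    using ring_hom_onD(2)[OF assms(1)] unital_subringD(2)[OF assms(2)] by blast
  then show ?thesis by simp
qed

lemma ring_hom_on_diff:
  assumes "ring_hom_on S f" and "unital_subring S" and "x \<in> S" and "y \<in> S"
  shows "f (x - y) = f x - f y"
proof -
  have "f (x - y + y) = f (x - y) + f y"
    using assms by (intro ring_hom_onD(2)[OF assms(1)] unital_subringD)
  then show ?thesis by simp
qed

lemma ring_hom_on_sum:
  assumes "ring_hom_on S f" and "unital_subring S" and "\<And>i. i \<in> I \<Longrightarrow> g i \<in> S"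
  shows "f (sum g I) = (\<Sum>i\<in>I. f (g i))"
  using assms(3)
proof (induction I rule: infinite_finite_induct)
  case (insert i I)
  have "f (g i + sum g I) = f (g i) + f (sum g I)"
    using insert.prems by (intro ring_hom_onD(2)[OF assms(1)] unital_subring_sum[OF assms(2)]) auto
  with insert show ?case by simp
qed (auto simp: ring_hom_on_zero[OF assms(1,2)])

lemma ring_hom_on_compose:
  assumes "ring_hom_on UNIV f" and "ring_hom_on UNIV g"
  shows "ring_hom_on UNIV (\<lambda>x. f (g x))"
  using assms by (auto simp: ring_hom_on_def)

lemma ring_hom_nonzero:
  fixes f :: "'a::division_ring \<Rightarrow> 'b::ring_1"
  assumes "ring_hom_on UNIV f" and "x \<noteq> 0"
  shows "f x \<noteq> 0"
proof
  assume "f x = 0"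
  have "f (x * inverse x) = f x * f (inverse x)"
    using ring_hom_onD(3)[OF assms(1)] by blast
  with assms(2) \<open>f x = 0\<close> show False using ring_hom_onD(1)[OF assms(1)] by simp
qed

lemma ring_hom_inj:
  fixes f :: "'a::division_ring \<Rightarrow> 'b::ring_1"
  assumes "ring_hom_on UNIV f"
  shows "inj f"
proof (rule injI, rule ccontr)
  fix x y assume "f x = f y" "x \<noteq> y"
  then have "f (x - y) = 0" by (simp add: ring_hom_on_diff[OF assms])
  with ring_hom_nonzero[OF assms, of "x - y"] \<open>x \<noteq> y\<close> show False by simp
qed

lemma ring_hom_inverse:
  fixes f :: "'a::division_ring \<Rightarrow> 'b::division_ring"
  assumes "ring_hom_on UNIV f"
  shows "f (inverse x) = inverse (f x)"
proof (cases "x = 0")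
  case True
  then show ?thesis by (simp add: ring_hom_on_zero[OF assms])
next
  case False
  have "f x * f (inverse x) = 1"
    using False ring_hom_onD(1,3)[OF assms] by (metis UNIV_I right_inverse)
  then show ?thesis by (metis inverse_unique)
qed

lemma division_subring_range:
  fixes f :: "'a::division_ring \<Rightarrow> 'b::division_ring"
  assumes "ring_hom_on UNIV f"
  shows "division_subring (range f)"
  unfolding division_subring_def unital_subring_def
proof (intro conjI ballI)
  show "1 \<in> range f" using ring_hom_onD(1)[OF assms] by (metis rangeI)
  fix x assume "x \<in> range f"
  then show "inverse x \<in> range f" by (auto simp: ring_hom_inverse[OF assms, symmetric])
  fix y assume "y \<in> range f"
  with \<open>x \<in> range f\<close> show "x - y \<in> range f" "x * y \<in> range f"
    by (auto simp: ring_hom_on_diff[OF assms, symmetric] ring_hom_onD(3)[OF assms, symmetric])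
qed

lemma division_subring_vimage:
  fixes f :: "'a::division_ring \<Rightarrow> 'b::division_ring"
  assumes "ring_hom_on UNIV f" and "division_subring S"
  shows "division_subring {x. f x \<in> S}"
  using assms(2) unfolding division_subring_def unital_subring_def
  by (simp add: ring_hom_inverse[OF assms(1)] ring_hom_on_diff[OF assms(1)]
      ring_hom_onD[OF assms(1)])

lemma division_subring_fixed_points:
  fixes f :: "'g \<Rightarrow> 'a::division_ring \<Rightarrow> 'a"
  assumes "\<And>g. g \<in> I \<Longrightarrow> ring_hom_on UNIV (f g)"
  shows "division_subring {x. \<forall>g\<in>I. f g x = x}"
  unfolding division_subring_def unital_subring_def
  by (auto simp: ring_hom_inverse[OF assms] ring_hom_on_diff[OF assms] ring_hom_onD[OF assms])

text \<open>Reduces a claim about all invariants to constants and elements of \<open>B\<close>. It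
  is applied to the kernel of a derivation and to the preimage of \<open>range \<Psi>\<close> under
  \<open>\<kappa>\<close>. The inner facts translate the operations of the record into those of the
  type class.\<close>

lemma generate_field_subset:
  fixes S :: "'a::field set"
  assumes "division_subring S" and "H \<subseteq> S"
  shows "generate_field ring_of_type_algebra H \<subseteq> S"
proof
  have S: "unital_subring S" and inv: "\<And>x. x \<in> S \<Longrightarrow> inverse x \<in> S"
    using assms(1) by (auto simp: division_subring_def)
  interpret field "ring_of_type_algebra :: 'a ring" by (rule field_from_type_algebra)
  let ?R = "ring_of_type_algebra :: 'a ring"
  have simps: "\<one>\<^bsub>?R\<^esub> = 1" "\<zero>\<^bsub>?R\<^esub> = 0" "x \<oplus>\<^bsub>?R\<^esub> y = x + y" "x \<otimes>\<^bsub>?R\<^esub> y = x * y" "carrier ?R = UNIV"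
    for x y :: 'a by (simp_all add: ring_of_type_algebra_def)
  have neg: "\<ominus>\<^bsub>?R\<^esub> x = - x" for x
    using minus_equality[of "- x" x] by (simp add: simps)
  have minv: "inv\<^bsub>?R\<^esub> x = inverse x" if "x \<noteq> 0" for x
    using comm_inv_char[of x "inverse x"] that by (simp add: simps)
  fix x assume "x \<in> generate_field ?R H"
  then show "x \<in> S"
    by induction (use assms(2) S in \<open>auto simp: simps neg minv intro: unital_subringD inv\<close>)
qed

locale right_fractions =
  fixes S :: "'a::division_ring set"
  assumes subring: "unital_subring S"
    and fraction: "\<exists>a\<in>S. \<exists>b\<in>S. b \<noteq> 0 \<and> f = a * inverse b"
begin

lemmas closed = unital_subringD[OF subring]

lemma ring_hom_eqI:
  fixes \<sigma> \<sigma>' :: "'a \<Rightarrow> 'b::division_ring"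
  assumes "ring_hom_on UNIV \<sigma>" and "ring_hom_on UNIV \<sigma>'" and "\<And>s. s \<in> S \<Longrightarrow> \<sigma> s = \<sigma>' s"
  shows "\<sigma> = \<sigma>'"
proof
  fix f
  obtain a b where "a \<in> S" "b \<in> S" "f = a * inverse b" using fraction by blast
  then show "\<sigma> f = \<sigma>' f"
    using assms by (simp add: ring_hom_onD ring_hom_inverse)
qed

text \<open>The ambient division ring contains \<open>inverse b * c\<close>, which is itself a right
  fraction \<open>u * inverse v\<close>; clearing denominators gives the right Ore
  condition.\<close>

lemma ore:
  assumes "b \<in> S" and "b \<noteq> 0" and "c \<in> S"
  obtains u v where "u \<in> S" "v \<in> S" "v \<noteq> 0" "c * v = b * u"
proof -
  obtain u v where uv: "u \<in> S" "v \<in> S" "v \<noteq> 0" "inverse b * c = u * inverse v"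
    using fraction by blast
  have "c * v = b * (inverse b * c) * v" using assms by (simp add: mult.assoc[symmetric])
  also have "\<dots> = b * u" using uv by (simp add: mult.assoc)
  finally show ?thesis using that uv by blast
qed

text \<open>Injectivity makes the images of denominators invertible, so \<open>a * inverse b\<close>
  can be sent to \<open>\<theta> a * inverse (\<theta> b)\<close>. Common right multiples of
  denominators show that this is well defined and additive.\<close>

lemma ring_hom_extension:
  fixes \<theta> :: "'a \<Rightarrow> 'b::division_ring"
  assumes hom: "ring_hom_on S \<theta>" and inj: "\<And>s. s \<in> S \<Longrightarrow> \<theta> s = 0 \<Longrightarrow> s = 0"
  shows "\<exists>\<sigma>. ring_hom_on UNIV \<sigma> \<and> (\<forall>s\<in>S. \<sigma> s = \<theta> s)"
proof -
  note hom_simps = ring_hom_onD[OF hom]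
  have well_defined: "\<theta> a * inverse (\<theta> b) = \<theta> c * inverse (\<theta> d)"
    if S: "a \<in> S" "b \<in> S" "c \<in> S" "d \<in> S" and nz: "b \<noteq> 0" "d \<noteq> 0"
      and eq: "a * inverse b = c * inverse d" for a b c d
  proof -
    \<comment> \<open>Both fractions are expanded to the common denominator
      \<open>d * v = b * u\<close>.\<close>
    obtain u v where uv: "u \<in> S" "v \<in> S" "v \<noteq> 0" "d * v = b * u"
      using ore S nz by blast
    have "u \<noteq> 0" using uv nz by auto
    have "a * u = a * inverse b * (b * u)" using nz by (simp add: mult.assoc[symmetric]) (simp add: mult.assoc)
    also have "\<dots> = c * v"
      unfolding eq uv(4)[symmetric] using nz by (metis mult.assoc left_inverse mult_1_left)
    finally have 1: "\<theta> a * \<theta> u = \<theta> c * \<theta> v" using S uv hom_simps(3) by metis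
    have 2: "\<theta> d * \<theta> v = \<theta> b * \<theta> u" using S uv hom_simps(3) by metis
    have nz': "\<theta> b \<noteq> 0" "\<theta> d \<noteq> 0" "\<theta> u \<noteq> 0" "\<theta> v \<noteq> 0"
      using inj S uv nz \<open>u \<noteq> 0\<close> by auto
    have "\<theta> a * inverse (\<theta> b) = \<theta> a * \<theta> u * inverse (\<theta> b * \<theta> u)"
      using nz' by (simp add: nonzero_inverse_mult_distrib mult.assoc) (simp add: mult.assoc[symmetric])
    also have "\<dots> = \<theta> c * \<theta> v * inverse (\<theta> d * \<theta> v)" using 1 2 by simp
    also have "\<dots> = \<theta> c * inverse (\<theta> d)"
      using nz' by (simp add: nonzero_inverse_mult_distrib mult.assoc) (simp add: mult.assoc[symmetric])
    finally show ?thesis .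
  qed
  obtain A B where AB: "\<And>f. A f \<in> S" "\<And>f. B f \<in> S" "\<And>f. B f \<noteq> 0" "\<And>f. f = A f * inverse (B f)"
    using fraction by metis
  define \<sigma> where "\<sigma> f = \<theta> (A f) * inverse (\<theta> (B f))" for f
  have \<sigma>: "\<sigma> (a * inverse b) = \<theta> a * inverse (\<theta> b)" if "a \<in> S" "b \<in> S" "b \<noteq> 0" for a b
    unfolding \<sigma>_def using AB that by (intro well_defined) auto
  have ext: "\<sigma> s = \<theta> s" if "s \<in> S" for s
    using \<sigma>[OF that closed(1)] by (simp add: hom_simps)
  have "\<sigma> (f + g) = \<sigma> f + \<sigma> g \<and> \<sigma> (f * g) = \<sigma> f * \<sigma> g" for f g
  proof
    define a b c d where abcd: "a = A f" "b = B f" "c = A g" "d = B g"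
    have S: "a \<in> S" "b \<in> S" "c \<in> S" "d \<in> S" and nz: "b \<noteq> 0" "d \<noteq> 0"
      and f: "f = a * inverse b" and g: "g = c * inverse d"
      using AB by (auto simp: abcd)
    have nz': "\<theta> b \<noteq> 0" "\<theta> d \<noteq> 0" using inj S nz by auto
    obtain u v where uv: "u \<in> S" "v \<in> S" "v \<noteq> 0" "d * v = b * u"
      using ore S nz by blast
    have "u \<noteq> 0" using uv nz by auto
    have m: "b * u \<in> S" "b * u \<noteq> 0" using S uv closed nz \<open>u \<noteq> 0\<close> by auto
    have f': "f = (a * u) * inverse (b * u)"
      using nz \<open>u \<noteq> 0\<close>
      by (simp add: f nonzero_inverse_mult_distrib mult.assoc) (simp add: mult.assoc[symmetric])
    have g': "g = (c * v) * inverse (b * u)"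
      using nz \<open>v \<noteq> 0\<close> unfolding uv(4)[symmetric]
      by (simp add: g nonzero_inverse_mult_distrib mult.assoc) (simp add: mult.assoc[symmetric])
    have "\<sigma> (f + g) = \<sigma> ((a * u + c * v) * inverse (b * u))"
      by (simp add: f' g' distrib_right)
    also have "\<dots> = \<theta> (a * u) * inverse (\<theta> (b * u)) + \<theta> (c * v) * inverse (\<theta> (b * u))"
      using S uv m \<sigma>[of "a * u + c * v" "b * u"] by (simp add: closed hom_simps distrib_right)
    also have "\<dots> = \<sigma> f + \<sigma> g"
      using S uv m by (simp add: f' g' \<sigma> closed)
    finally show "\<sigma> (f + g) = \<sigma> f + \<sigma> g" .
    \<comment> \<open>In \<open>a * inverse b * c * inverse d\<close> the middle part is on the
      wrong side; it is rewritten as \<open>u * inverse v\<close>, and the same rewriting is valid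
      for the images under \<open>\<theta>\<close>.\<close>
    obtain u v where uv: "u \<in> S" "v \<in> S" "v \<noteq> 0" "c * v = b * u"
      using ore S nz by blast
    have "inverse b * c * v = u" using uv nz by (simp add: mult.assoc) (simp add: mult.assoc[symmetric])
    then have bc: "inverse b * c = u * inverse v"
      using uv by (metis mult.assoc right_inverse mult_1_right)
    have "\<theta> v \<noteq> 0" using inj uv by auto
    have "\<theta> c * \<theta> v = \<theta> b * \<theta> u" using S uv hom_simps(3) by metis
    then have "inverse (\<theta> b) * \<theta> c * \<theta> v = \<theta> u"
      using nz' by (simp add: mult.assoc) (simp add: mult.assoc[symmetric])
    then have bc': "inverse (\<theta> b) * \<theta> c = \<theta> u * inverse (\<theta> v)"
      using \<open>\<theta> v \<noteq> 0\<close> by (metis mult.assoc right_inverse mult_1_right)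
    have "f * g = a * (inverse b * c) * inverse d" by (simp add: f g mult.assoc)
    also have "\<dots> = (a * u) * inverse (d * v)"
      using nz uv by (simp add: bc nonzero_inverse_mult_distrib mult.assoc)
    finally have "\<sigma> (f * g) = \<theta> a * \<theta> u * inverse (\<theta> d * \<theta> v)"
      using S uv nz by (simp add: \<sigma> closed hom_simps)
    also have "\<dots> = \<theta> a * (inverse (\<theta> b) * \<theta> c) * inverse (\<theta> d)"
      using nz' \<open>\<theta> v \<noteq> 0\<close> by (simp add: bc' nonzero_inverse_mult_distrib mult.assoc)
    also have "\<dots> = \<sigma> f * \<sigma> g" using S nz by (simp add: f g \<sigma> mult.assoc)
    finally show "\<sigma> (f * g) = \<sigma> f * \<sigma> g" .
  qed
  then have "ring_hom_on UNIV \<sigma>"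
    using ext closed(1) hom_simps(1) by (auto simp: ring_hom_on_def)
  with ext show ?thesis by blast
qed

end

section \<open>Polynomials and their derivations\<close>

lemma poly_mapping_sum_single:
  "p = (\<Sum>m\<in>Poly_Mapping.keys p. Poly_Mapping.single m (Poly_Mapping.lookup p m))"
  by (rule poly_mapping_eqI)
    (simp add: lookup_sum lookup_single when_def sum.delta in_keys_iff)

lemma Var_power: "Var i ^ n = (Poly_Mapping.single (Poly_Mapping.single i n) 1 :: ('v, 'k::comm_ring_1) mpoly)"
  by (induction n) (simp_all add: Var_def mult_single single_add[symmetric])

lemma single_monomial_eq_prod:
  "(Poly_Mapping.single m 1 :: ('v, 'k::comm_ring_1) mpoly) =
     (\<Prod>i\<in>Poly_Mapping.keys m. Var i ^ Poly_Mapping.lookup m i)"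
proof -
  have "(Poly_Mapping.single (\<Sum>i\<in>A. Poly_Mapping.single i (f i)) 1 :: ('v, 'k) mpoly) =
      (\<Prod>i\<in>A. Var i ^ f i)" if "finite A" for A and f :: "'v \<Rightarrow> nat"
    using that
  proof induction
    case (insert i A)
    have "(Poly_Mapping.single (\<Sum>i\<in>insert i A. Poly_Mapping.single i (f i)) 1 :: ('v, 'k) mpoly) =
        Var i ^ f i * Poly_Mapping.single (\<Sum>i\<in>A. Poly_Mapping.single i (f i)) 1"
      using insert.hyps by (simp add: Var_power mult_single)
    then show ?case using insert by simp
  qed simp
  from this[of "Poly_Mapping.keys m" "Poly_Mapping.lookup m"] show ?thesis
    by (simp flip: poly_mapping_sum_single)
qed

lemma mpoly_induct [case_names Const Var add mult]:
  fixes p :: "('v, 'k::comm_ring_1) mpoly"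
  assumes Const: "\<And>c. P (Const c)" and Var: "\<And>i. P (Var i)"
    and add: "\<And>p q. P p \<Longrightarrow> P q \<Longrightarrow> P (p + q)" and mult: "\<And>p q. P p \<Longrightarrow> P q \<Longrightarrow> P (p * q)"
  shows "P p"
proof -
  have zero: "P 0" and one: "P 1"
    using Const[of 0] Const[of 1] by (simp_all add: Const_def)
  have power: "P (Var i ^ n)" for i n
    by (induction n) (use one Var mult in auto)
  have prod: "P (\<Prod>i\<in>A. Var i ^ f i)" for A and f :: "'v \<Rightarrow> nat"
    by (induction A rule: infinite_finite_induct) (use one power mult in auto)
  have single: "P (Poly_Mapping.single m c)" for m c
  proof -
    have "Poly_Mapping.single m c = Const c * Poly_Mapping.single m 1"
      by (simp add: Const_def mult_single)
    also have "P \<dots>" unfolding single_monomial_eq_prod by (intro mult Const prod)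
    finally show ?thesis .
  qed
  have "P (\<Sum>m\<in>A. Poly_Mapping.single m (f m))" for A and f :: "('v \<Rightarrow>\<^sub>0 nat) \<Rightarrow> 'k"
    by (induction A rule: infinite_finite_induct) (use zero single add in auto)
  then show ?thesis by (subst poly_mapping_sum_single)
qed

lemma Const_simps [simp]:
  "Const 0 = 0" "Const 1 = 1" "Const (c + d) = Const c + Const d" "Const (c * d) = Const c * Const d"
  "Const c = 0 \<longleftrightarrow> c = 0"
  by (simp_all add: Const_def single_add mult_single) (metis lookup_single_eq lookup_zero single_zero)

lemma ring_hom_on_to_fract: "ring_hom_on UNIV to_fract"
  by (simp add: ring_hom_on_def)

lemma ring_hom_on_ratfun_const: "ring_hom_on UNIV ratfun_const"
  by (simp add: ring_hom_on_def ratfun_const_def)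

lemma lookup_Const_mult:
  "Poly_Mapping.lookup (Const c * p) m = c * Poly_Mapping.lookup p m"
proof -
  have "Poly_Mapping.lookup (Const c * (\<Sum>m\<in>A. Poly_Mapping.single m (f m))) m =
      c * Poly_Mapping.lookup (\<Sum>m\<in>A. Poly_Mapping.single m (f m)) m" for A f
    by (simp add: Const_def sum_distrib_left mult_single lookup_sum lookup_single mult_when)
  then show ?thesis by (metis poly_mapping_sum_single)
qed

lemma partial_add: "partial i (p + q) = partial i p + partial i q"
  by (rule poly_mapping_eqI) (simp add: lookup_partial lookup_add distrib_left)

lemma partial_Const_mult: "partial i (Const c * p) = Const c * partial i p"
  by (rule poly_mapping_eqI) (simp add: lookup_partial lookup_Const_mult mult.left_commute)

lemma partial_Var_mult: "partial i (Var j * p) = Var j * partial i p + (if i = j then p else 0)"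
  using partial_Var_commutator[of i j p] by (simp add: algebra_simps)

lemma partial_Const [simp]: "partial i (Const c) = 0"
proof (rule poly_mapping_eqI)
  fix m :: "'a \<Rightarrow>\<^sub>0 nat"
  have "Poly_Mapping.lookup (m + Poly_Mapping.single i 1) i \<noteq> Poly_Mapping.lookup (0 :: 'a \<Rightarrow>\<^sub>0 nat) i"
    by (simp add: lookup_add)
  then have "m + Poly_Mapping.single i 1 \<noteq> 0" by metis
  then show "Poly_Mapping.lookup (partial i (Const c)) m = Poly_Mapping.lookup 0 m"
    by (simp add: lookup_partial Const_def lookup_single)
qed

lemma partial_Var [simp]:
  "partial i (Var j :: ('v, 'k::comm_ring_1) mpoly) = (if i = j then 1 else 0)"
  using partial_Var_mult[of i j "1 :: ('v, 'k) mpoly"] partial_Const[of i "1 :: 'k"] by simp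

lemma partial_mult: "partial i (p * q) = partial i p * q + p * partial i q"
proof (induction p arbitrary: q rule: mpoly_induct)
  case (mult p r)
  show ?case unfolding mult.assoc mult.IH by (simp add: algebra_simps)
next
  case (add p r)
  show ?case unfolding distrib_right partial_add add.IH by (simp add: algebra_simps)
qed (simp_all add: partial_Const_mult partial_Var_mult add.commute)

text \<open>Both sides are derivations that vanish on constants and agree on the variables, and
  these generate the polynomial ring.\<close>

lemma mpoly_derivation_eq:
  fixes \<delta> :: "('n::finite, 'k::comm_ring_1) mpoly \<Rightarrow> ('n, 'k) mpoly"
  assumes "\<And>p q. \<delta> (p + q) = \<delta> p + \<delta> q" and "\<And>p q. \<delta> (p * q) = \<delta> p * q + p * \<delta> q"
    and "\<And>c. \<delta> (Const c) = 0"
  shows "\<delta> p = (\<Sum>i\<in>UNIV. \<delta> (Var i) * partial i p)"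
proof (induction p rule: mpoly_induct)
  case (Const c)
  then show ?case using assms(3) by simp
next
  case (Var j)
  then show ?case by (simp add: if_distrib[of "\<lambda>x. _ * x"] sum.delta cong: if_cong)
next
  case (add p q)
  then show ?case by (simp add: assms(1) partial_add distrib_left sum.distrib)
next
  case (mult p q)
  have "(\<Sum>i\<in>UNIV. \<delta> (Var i) * partial i (p * q)) =
      (\<Sum>i\<in>UNIV. \<delta> (Var i) * partial i p) * q + p * (\<Sum>i\<in>UNIV. \<delta> (Var i) * partial i q)"
    by (simp add: partial_mult sum.distrib sum_distrib_left sum_distrib_right algebra_simps)
  then show ?case using mult assms(2) by simp
qed

section \<open>Evaluation of polynomials as a ring homomorphism\<close>

lemma poly_eval_superset:
  assumes "s 0 = 0" and "finite A" and "Poly_Mapping.keys p \<subseteq> A"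
  shows "poly_eval s y p = (\<Sum>m\<in>A.
     s (Poly_Mapping.lookup p m) * (\<Prod>i\<in>Poly_Mapping.keys m. y i ^ Poly_Mapping.lookup m i))"
  unfolding poly_eval_def using assms
  by (intro sum.mono_neutral_left) (auto simp: in_keys_iff)

lemma ring_hom_on_poly_eval:
  fixes y :: "'n::finite \<Rightarrow> 'a::comm_ring_1"
  assumes s: "ring_hom_on UNIV s"
  shows "ring_hom_on UNIV (poly_eval s y)"
proof -
  let ?e = "poly_eval s y"
  have s0: "s 0 = 0" by (rule ring_hom_on_zero[OF s]) simp
  have keys: "(\<Prod>i\<in>Poly_Mapping.keys m. y i ^ Poly_Mapping.lookup m i) =
      (\<Prod>i\<in>UNIV. y i ^ Poly_Mapping.lookup m i)" for m
    by (intro prod.mono_neutral_left) (auto simp: in_keys_iff)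
  have single: "?e (Poly_Mapping.single m c) = s c * (\<Prod>i\<in>UNIV. y i ^ Poly_Mapping.lookup m i)" for m c
    by (subst poly_eval_superset[where A = "{m}"]) (auto simp: keys s0)
  have add: "?e (p + q) = ?e p + ?e q" for p q
  proof -
    let ?A = "Poly_Mapping.keys p \<union> Poly_Mapping.keys q"
    have "Poly_Mapping.keys (p + q) \<subseteq> ?A" by (rule keys_add)
    then show ?thesis
      by (simp add: poly_eval_superset[where A = ?A and s = s, OF s0] lookup_add ring_hom_onD[OF s] distrib_right
          sum.distrib)
  qed
  have zero: "?e 0 = 0" by (simp add: poly_eval_def)
  have sum: "?e (sum f A) = (\<Sum>a\<in>A. ?e (f a))" for f and A :: "('n \<Rightarrow>\<^sub>0 nat) set"
    by (induction A rule: infinite_finite_induct) (simp_all add: add zero)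
  have mult: "?e (p * q) = ?e p * ?e q" for p q
  proof -
    let ?t = "\<lambda>p m. Poly_Mapping.single m (Poly_Mapping.lookup p m)"
    have single_mult: "?e (?t p m * ?t q m') = ?e (?t p m) * ?e (?t q m')" for m m'
      by (simp add: mult_single single ring_hom_onD[OF s] lookup_add power_add prod.distrib ac_simps)
    have "?e (p * q) = ?e ((\<Sum>m\<in>Poly_Mapping.keys p. ?t p m) * (\<Sum>m\<in>Poly_Mapping.keys q. ?t q m))"
      by (simp flip: poly_mapping_sum_single)
    also have "\<dots> = (\<Sum>m\<in>Poly_Mapping.keys p. ?e (?t p m)) * (\<Sum>m\<in>Poly_Mapping.keys q. ?e (?t q m))"
      by (simp add: sum_product sum single_mult)
    also have "\<dots> = ?e p * ?e q"
      by (simp flip: sum poly_mapping_sum_single)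
    finally show ?thesis .
  qed
  have "?e 1 = 1"
    using single[of 0 1] ring_hom_onD(1)[OF s] by simp
  with add mult show ?thesis by (simp add: ring_hom_on_def)
qed

lemma poly_eval_Const:
  "s 0 = 0 \<Longrightarrow> poly_eval s y (Const c) = s c"
  by (subst poly_eval_superset[where A = "{0}"]) (auto simp: Const_def)

lemma poly_eval_Var:
  "s 0 = 0 \<Longrightarrow> s 1 = 1 \<Longrightarrow> poly_eval s y (Var i) = y i"
  by (subst poly_eval_superset[where A = "{Poly_Mapping.single i 1}"]) (auto simp: Var_def)

section \<open>Algebraic independence\<close>

text \<open>The definition of independence indexes the variables by the elements of
  \<open>B\<close>; here a relation is given by an injective family and exponent functions. The
  condition \<open>A \<subseteq> extensional I\<close> makes distinct elements of \<open>A\<close>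
  differ already on \<open>I\<close>, so that they give distinct monomials.\<close>

lemma algebraically_independent_family:
  fixes s :: "'k::field \<Rightarrow> 'a::field" and y :: "'i \<Rightarrow> 'a"
  assumes indep: "algebraically_independent s B" and s0: "s 0 = 0"
    and "finite I" and inj: "inj_on y I" and B: "y ` I \<subseteq> B"
    and "finite A" and A: "A \<subseteq> extensional I"
    and zero: "(\<Sum>\<alpha>\<in>A. s (c \<alpha>) * (\<Prod>i\<in>I. y i ^ \<alpha> i)) = 0"
    and "\<alpha> \<in> A"
  shows "c \<alpha> = 0"
proof -
  define e where "e \<alpha> = (\<Sum>i\<in>I. Poly_Mapping.single (y i) (\<alpha> i))" for \<alpha> :: "'i \<Rightarrow> nat"
  have lookup_e: "Poly_Mapping.lookup (e \<alpha>) (y i) = \<alpha> i" if "i \<in> I" for \<alpha> i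
  proof -
    have "Poly_Mapping.lookup (e \<alpha>) (y i) = (\<Sum>j\<in>I. if j = i then \<alpha> j else 0)"
      unfolding e_def lookup_sum using that inj
      by (intro sum.cong) (auto simp: lookup_single when_def inj_on_def)
    then show ?thesis using that \<open>finite I\<close> by (simp add: sum.delta)
  qed
  have keys_e: "Poly_Mapping.keys (e \<alpha>) \<subseteq> y ` I" for \<alpha>
    unfolding e_def using keys_sum by (force split: if_splits)
  have inj_e: "inj_on e A"
  proof (rule inj_onI)
    fix \<alpha> \<beta> assume "\<alpha> \<in> A" "\<beta> \<in> A" "e \<alpha> = e \<beta>"
    then show "\<alpha> = \<beta>" using A lookup_e by (metis extensionalityI subsetD)
  qed
  define P where "P = (\<Sum>\<alpha>\<in>A. Poly_Mapping.single (e \<alpha>) (c \<alpha>))"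
  have lookup_P: "Poly_Mapping.lookup P (e \<alpha>) = c \<alpha>" if "\<alpha> \<in> A" for \<alpha>
  proof -
    have "Poly_Mapping.lookup P (e \<alpha>) = (\<Sum>\<beta>\<in>A. if \<beta> = \<alpha> then c \<beta> else 0)"
      unfolding P_def lookup_sum using that inj_e
      by (intro sum.cong) (auto simp: lookup_single when_def inj_on_def)
    then show ?thesis using that \<open>finite A\<close> by (simp add: sum.delta)
  qed
  have keys_P: "Poly_Mapping.keys P \<subseteq> e ` A"
    unfolding P_def using keys_sum by (force split: if_splits)
  have monomial: "(\<Prod>b\<in>Poly_Mapping.keys (e \<alpha>). b ^ Poly_Mapping.lookup (e \<alpha>) b) = (\<Prod>i\<in>I. y i ^ \<alpha> i)"
    for \<alpha>
  proof -
    have "(\<Prod>b\<in>Poly_Mapping.keys (e \<alpha>). b ^ Poly_Mapping.lookup (e \<alpha>) b) =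
        (\<Prod>b\<in>y ` I. b ^ Poly_Mapping.lookup (e \<alpha>) b)"
      using keys_e \<open>finite I\<close> by (intro prod.mono_neutral_left) (auto simp: in_keys_iff)
    also have "\<dots> = (\<Prod>i\<in>I. y i ^ \<alpha> i)"
      using inj by (simp add: prod.reindex lookup_e)
    finally show ?thesis .
  qed
  have "poly_eval s (\<lambda>b. b) P = (\<Sum>m\<in>e ` A. s (Poly_Mapping.lookup P m) *
      (\<Prod>b\<in>Poly_Mapping.keys m. b ^ Poly_Mapping.lookup m b))"
    using s0 \<open>finite A\<close> keys_P by (intro poly_eval_superset) auto
  also have "\<dots> = 0"
    using inj_e zero by (simp add: sum.reindex lookup_P monomial)
  finally have "P = 0"
    using indep keys_P keys_e B unfolding algebraically_independent_def by (metis image_iff order_trans subsetD)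
  then show ?thesis using lookup_P[OF \<open>\<alpha> \<in> A\<close>] by simp
qed

lemma poly_eval_eq_0_iff_of_independent:
  fixes s :: "'k::field \<Rightarrow> 'a::field" and y :: "'n::finite \<Rightarrow> 'a"
  assumes "algebraically_independent s B" and s0: "s 0 = 0" and "inj y" and "range y \<subseteq> B"
  shows "poly_eval s y p = 0 \<longleftrightarrow> p = 0"
proof
  assume eval: "poly_eval s y p = 0"
  have inj: "inj_on Poly_Mapping.lookup A" for A :: "('n \<Rightarrow>\<^sub>0 nat) set"
    by (simp add: inj_on_def poly_mapping_eqI)
  have keys: "(\<Prod>i\<in>Poly_Mapping.keys m. y i ^ Poly_Mapping.lookup m i) =
      (\<Prod>i\<in>UNIV. y i ^ Poly_Mapping.lookup m i)" for m
    by (intro prod.mono_neutral_left) (auto simp: in_keys_iff)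
  let ?inv = "the_inv_into UNIV Poly_Mapping.lookup"
  have "(\<Sum>\<alpha>\<in>Poly_Mapping.lookup ` Poly_Mapping.keys p.
      s (Poly_Mapping.lookup p (?inv \<alpha>)) * (\<Prod>i\<in>UNIV. y i ^ \<alpha> i)) = 0"
    using eval unfolding poly_eval_def
    by (simp add: sum.reindex[OF inj] the_inv_into_f_f[OF inj] keys)
  then have "Poly_Mapping.lookup p (?inv (Poly_Mapping.lookup m)) = 0" if "m \<in> Poly_Mapping.keys p" for m
    using assms that by (intro algebraically_independent_family[OF assms(1) s0, of UNIV y
        "Poly_Mapping.lookup ` Poly_Mapping.keys p"]) auto
  then show "p = 0"
    by (intro poly_mapping_eqI) (auto simp: the_inv_into_f_f[OF inj] in_keys_iff)
qed (simp add: poly_eval_def)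

text \<open>Each exponent is bounded separately, not the total degree: such bounds still add under
  products, and the monomials below a bound form a box whose size is a power.\<close>

definition exponents_le :: "nat \<Rightarrow> ('v, 'k::zero) mpoly \<Rightarrow> bool" where
  "exponents_le d p \<longleftrightarrow> (\<forall>m\<in>Poly_Mapping.keys p. \<forall>i. Poly_Mapping.lookup m i \<le> d)"

lemma exponents_le_mono: "exponents_le d p \<Longrightarrow> d \<le> e \<Longrightarrow> exponents_le e p"
  unfolding exponents_le_def by (meson order_trans)

lemma exponents_le_1: "exponents_le 0 (1 :: ('v, 'k::comm_ring_1) mpoly)"
  unfolding exponents_le_def by (simp flip: single_one)

lemma exponents_le_mult:
  assumes "exponents_le d p" and "exponents_le e q"
  shows "exponents_le (d + e) (p * q)"
  unfolding exponents_le_def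
proof (intro ballI allI)
  fix m i assume "m \<in> Poly_Mapping.keys (p * q)"
  then obtain a b where "a \<in> Poly_Mapping.keys p" "b \<in> Poly_Mapping.keys q" "m = a + b"
    using keys_mult by blast
  with assms show "Poly_Mapping.lookup m i \<le> d + e"
    by (auto simp: exponents_le_def lookup_add intro!: add_mono)
qed

lemma exponents_le_power:
  fixes p :: "('v, 'k::comm_ring_1) mpoly"
  assumes "exponents_le d p"
  shows "exponents_le (n * d) (p ^ n)"
  by (induction n) (use assms exponents_le_1 exponents_le_mult in auto)

lemma exponents_le_prod:
  fixes f :: "'i \<Rightarrow> ('v, 'k::comm_ring_1) mpoly"
  assumes "\<And>i. i \<in> A \<Longrightarrow> exponents_le (d i) (f i)"
  shows "exponents_le (sum d A) (prod f A)"
  using assms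
  by (induction A rule: infinite_finite_induct) (auto intro: exponents_le_1 exponents_le_mult)

lemma exponents_le_exists: "\<exists>d. exponents_le d (p :: ('v::finite, 'k::zero) mpoly)"
proof -
  let ?E = "(\<lambda>(m, i). Poly_Mapping.lookup m i) ` (Poly_Mapping.keys p \<times> UNIV)"
  have "Poly_Mapping.lookup m i \<le> Max ?E" if "m \<in> Poly_Mapping.keys p" for m i
    using that by (intro Max_ge) force+
  then show ?thesis unfolding exponents_le_def by blast
qed

lemma card_exponent_box:
  fixes M :: nat
  defines "T \<equiv> {m :: 'v::finite \<Rightarrow>\<^sub>0 nat. \<forall>i. Poly_Mapping.lookup m i \<le> M}"
  shows "finite T" and "card T \<le> (M + 1) ^ card (UNIV :: 'v set)"
proof -
  let ?P = "PiE (UNIV :: 'v set) (\<lambda>_. {..M})"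
  have inj: "inj_on Poly_Mapping.lookup T" by (simp add: inj_on_def poly_mapping_eqI)
  have sub: "Poly_Mapping.lookup ` T \<subseteq> ?P" by (auto simp: T_def)
  have fin: "finite ?P" by (intro finite_PiE) auto
  show "finite T" using inj_on_finite[OF inj sub fin] .
  show "card T \<le> (M + 1) ^ card (UNIV :: 'v set)"
    using card_inj_on_le[OF inj sub fin] by (simp add: card_PiE)
qed

text \<open>After clearing denominators, the \<open>d ^ N\<close> monomials with exponents below \<open>d\<close> in \<open>N\<close> rational
  functions lie in a space whose dimension grows like \<open>d ^ n\<close>.\<close>

lemma card_algebraically_independent_le:
  fixes B :: "('n::{finite,linorder}, 'k::field) ratfun set"
  assumes indep: "algebraically_independent ratfun_const B" and "finite C" and "C \<subseteq> B"
  shows "card C \<le> card (UNIV :: 'n set)"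
proof (rule ccontr)
  assume "\<not> card C \<le> card (UNIV :: 'n set)"
  then have N: "card (UNIV :: 'n set) + 1 \<le> card C" by simp
  have "\<exists>p q. q \<noteq> 0 \<and> b = to_fract p / to_fract q" for b :: "('n, 'k) ratfun"
    by (metis Fract_cases Fract_conv_to_fract)
  then obtain num den :: "('n, 'k) ratfun \<Rightarrow> ('n, 'k) mpoly" where den: "\<And>b. den b \<noteq> 0"
    and frac: "\<And>b. b = to_fract (num b) / to_fract (den b)" by metis
  have "\<exists>d. exponents_le d (num b) \<and> exponents_le d (den b)" for b
    using exponents_le_exists[of "num b"] exponents_le_exists[of "den b"]
    by (meson exponents_le_mono max.cobounded1 max.cobounded2)
  then obtain f where f: "\<And>b. exponents_le (f b) (num b)" "\<And>b. exponents_le (f b) (den b)"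
    by metis
  define e where "e = sum f C"
  have e: "exponents_le e (num b)" "exponents_le e (den b)" if "b \<in> C" for b
    using that \<open>finite C\<close> f exponents_le_mono[of "f b" _ e] by (auto simp: e_def member_le_sum)
  \<comment> \<open>Write \<open>n\<close> for the number of variables and \<open>N\<close> for
    \<open>card C\<close>. Then \<open>M + 1 \<le> (N * e + 1) * d\<close>, and this
    \<open>d\<close> exceeds \<open>(N * e + 1) ^ n\<close>, so
    \<open>(M + 1) ^ n < d ^ (n + 1) \<le> d ^ N\<close>: there are more products of powers than
    coefficients to annihilate.\<close>
  define d where "d = (card C * e + 1) ^ card (UNIV :: 'n set) + 1"
  define M where "M = card C * (d * e)"
  define T where "T = {m :: 'n \<Rightarrow>\<^sub>0 nat. \<forall>i. Poly_Mapping.lookup m i \<le> M}"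
  define A where "A = PiE C (\<lambda>_. {..<d})"
  \<comment> \<open>For \<open>\<alpha>\<close> in \<open>A\<close> this is
    \<open>\<Prod>b\<in>C. b ^ \<alpha> b\<close> multiplied by
    \<open>\<Prod>b\<in>C. den b ^ d\<close>, a denominator that does not depend on
    \<open>\<alpha>\<close>.\<close>
  define p where "p \<alpha> = (\<Prod>b\<in>C. num b ^ \<alpha> b * den b ^ (d - \<alpha> b))" for \<alpha> :: "('n, 'k) ratfun \<Rightarrow> nat"
  have d: "d \<ge> 1" by (simp add: d_def)
  have "finite A" unfolding A_def using \<open>finite C\<close> by (intro finite_PiE) auto
  have "card T \<le> (M + 1) ^ card (UNIV :: 'n set)" unfolding T_def by (rule card_exponent_box)
  also have "\<dots> \<le> ((card C * e + 1) * d) ^ card (UNIV :: 'n set)"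
    using d by (intro power_mono) (auto simp: M_def algebra_simps)
  also have "\<dots> = (card C * e + 1) ^ card (UNIV :: 'n set) * d ^ card (UNIV :: 'n set)"
    by (rule power_mult_distrib)
  also have "\<dots> < d * d ^ card (UNIV :: 'n set)"
    using d by (intro mult_strict_right_mono) (simp_all only: d_def, simp_all)
  also have "\<dots> = d ^ (card (UNIV :: 'n set) + 1)" by simp
  also have "\<dots> \<le> d ^ card C" using N d by (intro power_increasing)
  also have "\<dots> = card A" using \<open>finite C\<close> by (simp add: A_def card_PiE)
  finally have card: "card T < card A" .
  \<comment> \<open>One equation for each monomial in the box \<open>T\<close>, one unknown for each
    exponent function in \<open>A\<close>.\<close>
  obtain c where c: "\<exists>\<alpha>\<in>A. c \<alpha> \<noteq> 0"
    and c0: "\<And>m. m \<in> T \<Longrightarrow> (\<Sum>\<alpha>\<in>A. Poly_Mapping.lookup (p \<alpha>) m * c \<alpha>) = 0"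
    using homogeneous_system_nontrivial_solution[OF _ \<open>finite A\<close> card,
        of "\<lambda>m \<alpha>. Poly_Mapping.lookup (p \<alpha>) m"] card_exponent_box(1)[of M]
    unfolding T_def by blast
  have exps: "exponents_le M (p \<alpha>)" if "\<alpha> \<in> A" for \<alpha>
  proof -
    have "exponents_le (d * e) (num b ^ \<alpha> b * den b ^ (d - \<alpha> b))" if "b \<in> C" for b
    proof -
      have "\<alpha> b \<le> d" using \<open>\<alpha> \<in> A\<close> that by (auto simp: A_def PiE_def Pi_def intro: less_imp_le)
      then have "\<alpha> b * e + (d - \<alpha> b) * e = d * e" by (simp flip: add_mult_distrib)
      with exponents_le_mult[OF exponents_le_power exponents_le_power, OF e[OF that], of "\<alpha> b" "d - \<alpha> b"]
      show ?thesis by simp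
    qed
    from exponents_le_prod[OF this, of C "\<lambda>b. b"] show ?thesis
      by (simp add: p_def M_def)
  qed
  have "(\<Sum>\<alpha>\<in>A. Const (c \<alpha>) * p \<alpha>) = 0"
  proof (rule poly_mapping_eqI)
    fix m
    show "Poly_Mapping.lookup (\<Sum>\<alpha>\<in>A. Const (c \<alpha>) * p \<alpha>) m = Poly_Mapping.lookup 0 m"
    proof (cases "m \<in> T")
      case True
      then show ?thesis
        using c0 unfolding lookup_sum lookup_Const_mult by (simp add: mult.commute)
    next
      case False
      then have "Poly_Mapping.lookup (p \<alpha>) m = 0" if "\<alpha> \<in> A" for \<alpha>
        using exps[OF that] by (auto simp: exponents_le_def T_def in_keys_iff)
      then show ?thesis by (simp add: lookup_sum lookup_Const_mult)
    qed
  qed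
  then have "(\<Sum>\<alpha>\<in>A. ratfun_const (c \<alpha>) * to_fract (p \<alpha>)) = 0"
    by (simp add: ratfun_const_def flip: to_fract_mult to_fract_sum)
  moreover define D where "D = (\<Prod>b\<in>C. to_fract (den b) ^ d)"
  have "to_fract (p \<alpha>) = D * (\<Prod>b\<in>C. b ^ \<alpha> b)" if "\<alpha> \<in> A" for \<alpha>
  proof -
    have power: "to_fract (q ^ n) = to_fract q ^ n" for q :: "('n, 'k) mpoly" and n
      by (induction n) simp_all
    have prod: "to_fract (prod g C) = (\<Prod>b\<in>C. to_fract (g b))" for g :: "_ \<Rightarrow> ('n, 'k) mpoly"
      using \<open>finite C\<close> by induction simp_all
    have "to_fract (num b) ^ \<alpha> b * to_fract (den b) ^ (d - \<alpha> b) = to_fract (den b) ^ d * b ^ \<alpha> b"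
      if "b \<in> C" for b
    proof -
      have "\<alpha> b \<le> d" using \<open>\<alpha> \<in> A\<close> that by (auto simp: A_def PiE_def Pi_def intro: less_imp_le)
      moreover have "to_fract (num b) = to_fract (den b) * b"
        using den[of b] by (subst (2) frac) simp
      ultimately show ?thesis by (simp add: power_mult_distrib flip: power_add)
    qed
    then show ?thesis by (simp add: p_def prod power D_def flip: prod.distrib)
  qed
  ultimately have "D * (\<Sum>\<alpha>\<in>A. ratfun_const (c \<alpha>) * (\<Prod>b\<in>C. b ^ \<alpha> b)) = 0"
    by (simp add: sum_distrib_left mult.left_commute)
  moreover have "D \<noteq> 0" using den \<open>finite C\<close> by (simp add: D_def)
  ultimately have "(\<Sum>\<alpha>\<in>A. ratfun_const (c \<alpha>) * (\<Prod>b\<in>C. b ^ \<alpha> b)) = 0" by simp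
  then have "c \<alpha> = 0" if "\<alpha> \<in> A" for \<alpha>
    using algebraically_independent_family[OF indep _ \<open>finite C\<close>, of "\<lambda>b. b" A c \<alpha>]
      \<open>finite A\<close> \<open>C \<subseteq> B\<close> that by (auto simp: A_def PiE_def ratfun_const_def)
  with c show False by blast
qed

section \<open>Derivations\<close>

definition derivation :: "('a::ring_1 \<Rightarrow> 'a) \<Rightarrow> bool" where
  "derivation \<delta> \<longleftrightarrow> (\<forall>u v. \<delta> (u + v) = \<delta> u + \<delta> v \<and> \<delta> (u * v) = \<delta> u * v + u * \<delta> v)"

lemma derivationD:
  assumes "derivation \<delta>"
  shows "\<delta> (u + v) = \<delta> u + \<delta> v" and "\<delta> (u * v) = \<delta> u * v + u * \<delta> v"
    and "\<delta> 0 = 0" and "\<delta> 1 = 0" and "\<delta> (u - v) = \<delta> u - \<delta> v"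
proof -
  show add: "\<delta> (u + v) = \<delta> u + \<delta> v" and mult: "\<delta> (u * v) = \<delta> u * v + u * \<delta> v" for u v
    using assms by (auto simp: derivation_def)
  show "\<delta> 0 = 0" using add[of 0 0] by simp
  show "\<delta> 1 = 0" using mult[of 1 1] by simp
  show "\<delta> (u - v) = \<delta> u - \<delta> v" using add[of "u - v" v] by (simp add: algebra_simps)
qed

lemma division_subring_derivation_kernel:
  fixes \<delta> :: "'a::field \<Rightarrow> 'a"
  assumes "derivation \<delta>"
  shows "division_subring {u. \<delta> u = 0}"
proof -
  note simps = derivationD[OF assms]
  have "\<delta> (inverse u) = 0" if "\<delta> u = 0" for u
  proof (cases "u = 0")
    case False
    then have "\<delta> (u * inverse u) = 0" by (simp add: simps)
    then have "u * \<delta> (inverse u) = 0" unfolding simps(2) that by simp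
    with False show ?thesis by simp
  qed (simp add: simps)
  then show ?thesis
    by (auto simp: division_subring_def unital_subring_def simps)
qed

lemma derivation_combination:
  fixes D :: "'i \<Rightarrow> 'a::field \<Rightarrow> 'a"
  assumes "\<And>i. i \<in> I \<Longrightarrow> derivation (D i)"
  shows "derivation (\<lambda>u. \<Sum>i\<in>I. c i * D i u)"
  using assms
  by (simp add: derivation_def distrib_left sum.distrib sum_distrib_right sum_distrib_left ac_simps)

lemma derivation_poly:
  fixes \<delta> :: "'a::field \<Rightarrow> 'a"
  assumes "derivation \<delta>" and "\<And>n. \<delta> (coeff p n) = 0"
  shows "\<delta> (poly p u) = poly (pderiv p) u * \<delta> u"
  using assms(2)
proof (induction p)
  case (pCons a p)
  have "\<delta> a = 0" "\<delta> (coeff p n) = 0" for n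
    using pCons.prems[of 0] pCons.prems[of "Suc n"] by simp_all
  with pCons.IH show ?case
    by (simp add: derivationD[OF assms(1)] pderiv_pCons algebra_simps)
qed (simp add: derivationD[OF assms(1)])


section \<open>Fields of fractions\<close>

text \<open>Lets \<open>finite_group_on_field\<close>, whose field has characteristic zero, be
  instantiated with the rational functions.\<close>

instance fract :: ("{idom, ring_char_0}") field_char_0
proof
  have "of_nat n = to_fract (of_nat n :: 'a)" for n by (induction n) simp_all
  then show "inj (of_nat :: nat \<Rightarrow> 'a fract)" by (auto intro: injI)
qed

lemma fract_in_division_subring:
  fixes u :: "'r::idom fract"
  assumes "division_subring S" and "range to_fract \<subseteq> S"
  shows "u \<in> S"
proof -
  obtain p q :: 'r where "u = to_fract p * inverse (to_fract q)"
    by (metis Fract_cases Fract_conv_to_fract divide_inverse)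
  moreover have "to_fract p \<in> S" "inverse (to_fract q) \<in> S"
    using assms by (auto simp: division_subring_def)
  ultimately show ?thesis using assms(1) by (simp add: division_subring_def unital_subring_def)
qed

lemma right_fractions_to_fract: "right_fractions (range (to_fract :: 'r::idom \<Rightarrow> 'r fract))"
proof
  show "unital_subring (range (to_fract :: 'r \<Rightarrow> 'r fract))"
    unfolding unital_subring_def
    by (auto simp flip: to_fract_1 to_fract_diff to_fract_mult)
  fix f :: "'r fract"
  obtain a b :: 'r where "b \<noteq> 0" "f = to_fract a / to_fract b"
    by (metis Fract_cases Fract_conv_to_fract)
  then show "\<exists>a\<in>range to_fract. \<exists>b\<in>range to_fract. b \<noteq> 0 \<and> f = a * inverse b"
    by (auto simp: divide_inverse)
qed

lemma fract_hom_extension: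
  fixes f :: "'r::idom \<Rightarrow> 'b::division_ring"
  assumes "ring_hom_on UNIV f" and "\<And>p. f p = 0 \<Longrightarrow> p = 0"
  shows "\<exists>\<sigma>. ring_hom_on UNIV \<sigma> \<and> (\<forall>p. \<sigma> (to_fract p) = f p)"
proof -
  interpret right_fractions "range (to_fract :: 'r \<Rightarrow> 'r fract)" by (rule right_fractions_to_fract)
  have inv: "inv_into UNIV to_fract (to_fract p) = p" for p :: 'r
    by (intro inv_f_f injI) simp
  have "ring_hom_on (range to_fract) (\<lambda>u. f (inv_into UNIV to_fract u))"
    using assms(1) by (auto simp: ring_hom_on_def inv simp flip: to_fract_1 to_fract_add to_fract_mult)
  moreover have "s = 0" if "s \<in> range to_fract" "f (inv_into UNIV to_fract s) = 0" for s
    using that assms(2) by (auto simp: inv)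
  ultimately obtain \<sigma> where "ring_hom_on UNIV \<sigma>" "\<forall>s\<in>range to_fract. \<sigma> s = f (inv_into UNIV to_fract s)"
    using ring_hom_extension by blast
  then show ?thesis by (intro exI[of _ \<sigma>]) (simp add: inv)
qed

lemma fract_hom_eqI:
  fixes \<sigma> \<sigma>' :: "'r::idom fract \<Rightarrow> 'b::division_ring"
  assumes "ring_hom_on UNIV \<sigma>" and "ring_hom_on UNIV \<sigma>'" and "\<And>p. \<sigma> (to_fract p) = \<sigma>' (to_fract p)"
  shows "\<sigma> = \<sigma>'"
  using right_fractions.ring_hom_eqI[OF right_fractions_to_fract assms(1,2)] assms(3) by blast

lemma fraction_extension_eqI:
  fixes \<sigma> :: "'a::division_ring \<Rightarrow> 'a"
  assumes "right_fractions (\<iota> ` A)" and hom: "ring_hom_on UNIV \<sigma>" and "bij \<sigma>"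
    and ext: "\<And>a. a \<in> A \<Longrightarrow> \<sigma> (\<iota> a) = \<iota> (f a)"
  shows "fraction_extension \<iota> A f = \<sigma>"
  unfolding fraction_extension_def
proof (rule the_equality)
  show "ring_automorphism \<sigma> \<and> (\<forall>a\<in>A. \<sigma> (\<iota> a) = \<iota> (f a))"
    using hom \<open>bij \<sigma>\<close> ext by (simp add: ring_automorphism_def ring_hom_on_def)
next
  interpret right_fractions "\<iota> ` A" by fact
  fix \<tau> assume \<tau>: "ring_automorphism \<tau> \<and> (\<forall>a\<in>A. \<tau> (\<iota> a) = \<iota> (f a))"
  \<comment> \<open>The predicate \<open>ring_automorphism\<close> does not mention the unit; a
    preimage of 1 forces \<open>\<tau> 1 = 1\<close>.\<close>
  obtain u where u: "\<tau> u = 1" using \<tau> by (metis bij_pointE ring_automorphism_def)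
  have "\<tau> (u * 1) = \<tau> u * \<tau> 1" using \<tau> by (simp only: ring_automorphism_def)
  with u have "\<tau> 1 = 1" by simp
  then have "ring_hom_on UNIV \<tau>" using \<tau> by (simp add: ring_hom_on_def ring_automorphism_def)
  then show "\<tau> = \<sigma>" using hom \<tau> ext by (intro ring_hom_eqI) auto
qed


text \<open>Bijectivity comes from an extension \<open>t\<close> of the inverse map: both composites
  of \<open>s\<close> and \<open>t\<close> agree with the identity on the image of \<open>A\<close>,
  hence everywhere.\<close>

lemma fraction_extension_eq:
  fixes s t :: "'a::division_ring \<Rightarrow> 'a"
  assumes frac: "right_fractions (\<iota> ` A)" and s: "ring_hom_on UNIV s" and t: "ring_hom_on UNIV t"
    and s_ext: "\<And>a. a \<in> A \<Longrightarrow> s (\<iota> a) = \<iota> (f a)" and t_ext: "\<And>a. a \<in> A \<Longrightarrow> t (\<iota> a) = \<iota> (f' a)"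
    and closed: "\<And>a. a \<in> A \<Longrightarrow> f a \<in> A" "\<And>a. a \<in> A \<Longrightarrow> f' a \<in> A"
    and inverse: "\<And>a. a \<in> A \<Longrightarrow> f (f' a) = a" "\<And>a. a \<in> A \<Longrightarrow> f' (f a) = a"
  shows "fraction_extension \<iota> A f = s"
proof (rule fraction_extension_eqI[OF frac s])
  have id: "ring_hom_on UNIV (\<lambda>u::'a. u)" by (simp add: ring_hom_on_def)
  have "(\<lambda>u. s (t u)) = (\<lambda>u. u)"
    by (rule right_fractions.ring_hom_eqI[OF frac ring_hom_on_compose[OF s t] id])
      (auto simp: s_ext t_ext closed inverse)
  moreover have "(\<lambda>u. t (s u)) = (\<lambda>u. u)"
    by (rule right_fractions.ring_hom_eqI[OF frac ring_hom_on_compose[OF t s] id])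
      (auto simp: s_ext t_ext closed inverse)
  ultimately show "bij s" by (intro o_bij[of t]) (simp_all add: fun_eq_iff)
qed (rule s_ext)


section \<open>The field of invariants of a finite group\<close>

locale finite_group_on_field = group G for G :: "('g, 'm) monoid_scheme" (structure) +
  fixes \<gamma> :: "'g \<Rightarrow> 'a::field_char_0 \<Rightarrow> 'a"
  assumes fin: "finite (carrier G)"
    and hom: "g \<in> carrier G \<Longrightarrow> ring_hom_on UNIV (\<gamma> g)"
    and act_one: "\<gamma> \<one> u = u"
    and act_mult: "g \<in> carrier G \<Longrightarrow> h \<in> carrier G \<Longrightarrow> \<gamma> (g \<otimes> h) u = \<gamma> g (\<gamma> h u)"
begin

definition fixed :: "'a set" where
  "fixed = {u. \<forall>g\<in>carrier G. \<gamma> g u = u}"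

definition trace :: "'a \<Rightarrow> 'a" where
  "trace u = (\<Sum>g\<in>carrier G. \<gamma> g u)"

lemma division_subring_fixed: "division_subring fixed"
  unfolding fixed_def using hom by (rule division_subring_fixed_points)

lemma trace_fixed: "trace u \<in> fixed"
  unfolding fixed_def
proof (intro CollectI ballI)
  fix h assume h: "h \<in> carrier G"
  have "\<gamma> h (trace u) = (\<Sum>g\<in>carrier G. \<gamma> (h \<otimes> g) u)"
    using h by (simp add: trace_def ring_hom_on_sum[OF hom] act_mult)
  also have "\<dots> = (\<Sum>g\<in>(\<lambda>g. h \<otimes> g) ` carrier G. \<gamma> g u)"
    using h by (simp add: sum.reindex inj_on_cmult)
  also have "\<dots> = trace u"
    using h by (simp add: surj_const_mult trace_def)
  finally show "\<gamma> h (trace u) = trace u" .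
qed

lemma trace_1: "trace 1 = of_nat (card (carrier G))"
  by (simp add: trace_def ring_hom_onD[OF hom])

text \<open>Artin's lemma. Since \<^prop>\<open>trace 1 \<noteq> 0\<close>, a solution of the system of all conjugates of the relation
  can be scaled so that applying the trace to its coefficients leaves a nontrivial relation.\<close>

lemma fixed_linear_dependence:
  fixes u :: "'j \<Rightarrow> 'a"
  assumes "finite J" and "card (carrier G) < card J"
  shows "\<exists>c. (\<forall>j. c j \<in> fixed) \<and> (\<exists>j\<in>J. c j \<noteq> 0) \<and> (\<Sum>j\<in>J. c j * u j) = 0"
proof -
  obtain c where c: "\<exists>j\<in>J. c j \<noteq> 0" and zero: "\<And>g. g \<in> carrier G \<Longrightarrow> (\<Sum>j\<in>J. \<gamma> g (u j) * c j) = 0"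
    using homogeneous_system_nontrivial_solution[OF fin assms, of "\<lambda>g j. \<gamma> g (u j)"] by blast
  then obtain j0 where j0: "j0 \<in> J" "c j0 \<noteq> 0" by blast
  define d where "d j = trace (c j * inverse (c j0))" for j
  have "(\<Sum>j\<in>J. \<gamma> h (c j * inverse (c j0)) * u j) = 0" if h: "h \<in> carrier G" for h
  proof -
    \<comment> \<open>Applying \<open>\<gamma> h\<close> to the relation for \<open>inv h\<close>
      undoes the conjugation of \<open>u j\<close> and moves it to the coefficient
      \<open>c j\<close>.\<close>
    have "\<gamma> h (\<Sum>j\<in>J. \<gamma> (inv h) (u j) * c j) = (\<Sum>j\<in>J. u j * \<gamma> h (c j))"
      using h by (simp add: ring_hom_on_sum[OF hom] ring_hom_onD[OF hom] act_one flip: act_mult)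
    then have "(\<Sum>j\<in>J. u j * \<gamma> h (c j)) * \<gamma> h (inverse (c j0)) = 0"
      using h zero[of "inv h"] by (simp add: ring_hom_on_zero[OF hom])
    then show ?thesis
      using h unfolding sum_distrib_right by (simp add: ring_hom_onD[OF hom] ac_simps)
  qed
  then have "(\<Sum>h\<in>carrier G. \<Sum>j\<in>J. \<gamma> h (c j * inverse (c j0)) * u j) = 0" by simp
  then have "(\<Sum>j\<in>J. d j * u j) = 0"
    by (subst (asm) sum.swap) (simp add: d_def trace_def sum_distrib_right)
  moreover have "d j0 \<noteq> 0"
    using j0 fin trace_1 by (auto simp: d_def)
  moreover have "d j \<in> fixed" for j by (simp add: d_def trace_fixed)
  ultimately show ?thesis using j0 by blast
qed

text \<open>By Artin's lemma a linearly independent set has at most \<open>card (carrier G)\<close>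
  elements, so one of maximal size exists, and maximality makes it span.\<close>

lemma finite_spanning_set:
  "\<exists>E. finite E \<and> (\<forall>u. \<exists>c. (\<forall>e. c e \<in> fixed) \<and> u = (\<Sum>e\<in>E. c e * e))"
proof -
  define indep where "indep E \<longleftrightarrow>
    (\<forall>c. (\<forall>e. c e \<in> fixed) \<longrightarrow> (\<Sum>e\<in>E. c e * e) = 0 \<longrightarrow> (\<forall>e\<in>E. c e = 0))" for E
  define good where "good E \<longleftrightarrow> finite E \<and> indep E" for E
  have "card E \<le> card (carrier G)" if "good E" for E
  proof (rule ccontr)
    assume "\<not> card E \<le> card (carrier G)"
    then have "card (carrier G) < card E" by simp
    with fixed_linear_dependence[of E "\<lambda>e. e"] that show False
      by (auto simp: good_def indep_def)
  qed
  moreover have "good {}" by (simp add: good_def indep_def)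
  ultimately obtain E where E: "good E" and max: "\<And>E'. good E' \<Longrightarrow> card E' \<le> card E"
    using ex_has_greatest_nat[of good "{}" card "card (carrier G) + 1"] by (metis less_Suc_eq_le Suc_eq_plus1)
  have "finite E" and ind: "indep E" using E by (auto simp: good_def)
  note S = division_subring_fixed[unfolded division_subring_def]
  have "\<exists>c. (\<forall>e. c e \<in> fixed) \<and> u = (\<Sum>e\<in>E. c e * e)" for u
  proof (cases "u \<in> E")
    case True
    then have "(\<Sum>e\<in>E. (if e = u then 1 else 0) * e) = u"
      using \<open>finite E\<close> by (simp add: if_distrib[of "\<lambda>x. x * _"] sum.delta cong: if_cong)
    then show ?thesis using unital_subringD[of fixed] S
      by (intro exI[of _ "\<lambda>e. if e = u then 1 else 0"]) auto
  next
    case False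
    with max[of "insert u E"] \<open>finite E\<close> have "\<not> indep (insert u E)" by (auto simp: good_def)
    then obtain c where c: "\<And>e. c e \<in> fixed" "(\<Sum>e\<in>insert u E. c e * e) = 0"
        "\<exists>e\<in>insert u E. c e \<noteq> 0"
      by (auto simp: indep_def)
    have sum: "c u * u + (\<Sum>e\<in>E. c e * e) = 0" using c(2) False \<open>finite E\<close> by simp
    have "c u \<noteq> 0"
    proof
      assume "c u = 0"
      with sum c ind show False by (auto simp: indep_def)
    qed
    then have "u = (\<Sum>e\<in>E. - (inverse (c u) * c e) * e)"
      using sum by (simp add: sum_negf mult.assoc flip: sum_distrib_left)
        (metis add.commute add_eq_0_iff mult.left_commute mult_minus_right nonzero_mult_div_cancel_left divide_inverse mult.commute)
    moreover have "- (inverse (c u) * c e) \<in> fixed" for e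
      using S c(1) by (auto intro: unital_subringD)
    ultimately show ?thesis by (intro exI[of _ "\<lambda>e. - (inverse (c u) * c e)"]) blast
  qed
  with \<open>finite E\<close> show ?thesis by blast
qed

text \<open>The derivative of the minimal polynomial of \<open>u\<close> over the invariants does not vanish at \<open>u\<close>.\<close>

lemma derivation_eq_0:
  assumes der: "derivation \<delta>" and fixed: "\<And>l. l \<in> fixed \<Longrightarrow> \<delta> l = 0"
  shows "\<delta> u = 0"
proof -
  define good where "good p \<longleftrightarrow> p \<noteq> 0 \<and> (\<forall>n. coeff p n \<in> fixed) \<and> poly p u = 0" for p
  have "\<exists>p. good p"
  proof -
    let ?N = "card (carrier G)"
    obtain c where c: "\<And>j. c j \<in> fixed" "\<exists>j\<in>{..?N}. c j \<noteq> 0" "(\<Sum>j\<le>?N. c j * u ^ j) = 0"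
      using fixed_linear_dependence[of "{..?N}" "\<lambda>j. u ^ j"] by auto
    define p where "p = (\<Sum>j\<le>?N. monom (c j) j)"
    have coeff: "coeff p n = (if n \<le> ?N then c n else 0)" for n
      by (simp add: p_def coeff_sum)
    have "poly p u = 0" using c(3) by (simp add: p_def poly_sum poly_monom)
    moreover have "p \<noteq> 0" using c(2) coeff by (metis coeff_0 atMost_iff)
    moreover have "coeff p n \<in> fixed" for n
      using c(1) unital_subringD(2) division_subring_fixed
      by (auto simp: coeff division_subring_def)
    ultimately show ?thesis by (auto simp: good_def)
  qed
  \<comment> \<open>Least degree replaces the minimal polynomial; \<open>p\<close> need not be
    monic. Its derivative has smaller degree and is nonzero in characteristic zero, so it cannot
    vanish at \<open>u\<close>.\<close>
  then obtain p where p: "good p" and min: "\<And>q. good q \<Longrightarrow> degree p \<le> degree q"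
    using ex_has_least_nat[of good _ degree] by metis
  have "poly (pderiv p) u * \<delta> u = \<delta> (poly p u)"
    using p fixed by (intro derivation_poly[OF der, symmetric]) (auto simp: good_def)
  also have "\<dots> = 0" using p derivationD(3)[OF der] by (simp add: good_def)
  finally have prod: "poly (pderiv p) u * \<delta> u = 0" .
  have "degree p \<noteq> 0"
  proof
    assume "degree p = 0"
    then obtain a where "p = [:a:]" by (metis degree_eq_zeroE)
    with p show False by (auto simp: good_def)
  qed
  then have nz: "pderiv p \<noteq> 0" and "degree (pderiv p) < degree p"
    by (simp_all add: pderiv_eq_0_iff degree_pderiv)
  then have "\<not> good (pderiv p)" using min by (meson not_less)
  moreover have "coeff (pderiv p) n \<in> fixed" for n
    unfolding coeff_pderiv using p division_subring_fixed
    by (auto simp: good_def division_subring_def intro!: unital_subringD(6) unital_subring_of_nat simp del: of_nat_Suc)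
  ultimately have "poly (pderiv p) u \<noteq> 0" using nz by (auto simp: good_def)
  with prod show ?thesis by simp
qed

end

section \<open>Normal forms in the Weyl algebra\<close>

text \<open>The Weyl relations, with all polynomials in place of the variables. The instances are
  \<open>mul\<close>, \<open>der\<close> for the given algebra and \<open>\<tau>\<close>,
  \<open>\<Delta>\<close> for its copy among the invariants.\<close>

locale weyl_representation =
  fixes \<tau> :: "('n::linorder, 'k::field_char_0) mpoly \<Rightarrow> 'f::ring_1" and \<Delta> :: "'n \<Rightarrow> 'f"
  assumes \<tau>_hom: "ring_hom_on UNIV \<tau>"
    and \<tau>_eq_0: "\<tau> p = 0 \<Longrightarrow> p = 0"
    and \<Delta>_commute: "\<Delta> i * \<Delta> j = \<Delta> j * \<Delta> i"
    and \<Delta>_\<tau>: "\<Delta> i * \<tau> p = \<tau> p * \<Delta> i + \<tau> (partial i p)"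
begin

lemmas \<tau>_simps = ring_hom_onD[OF \<tau>_hom, simplified] ring_hom_on_zero[OF \<tau>_hom, simplified]

sublocale fold: comp_fun_commute "\<lambda>i f. \<Delta> i * f"
  by standard (simp add: fun_eq_iff \<Delta>_commute flip: mult.assoc)

text \<open>Since the \<open>\<Delta> i\<close> commute, a multiset records a monomial in them;
  \<open>count M i\<close> is the exponent of \<open>\<Delta> i\<close>.\<close>

definition mon :: "'n multiset \<Rightarrow> 'f" where
  "mon M = fold_mset (\<lambda>i f. \<Delta> i * f) 1 M"

lemma mon_simps [simp]: "mon {#} = 1" "mon (add_mset i M) = \<Delta> i * mon M"
  by (simp_all add: mon_def)

lemma \<tau>_of_nat: "\<tau> (of_nat n) = of_nat n"
  by (induction n) (simp_all add: \<tau>_simps)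

text \<open>The commutator with a variable acts on monomials in the \<open>\<Delta> i\<close> as the
  formal derivative with respect to the matching \<open>\<Delta> i\<close>.\<close>

lemma mon_Var:
  "mon M * \<tau> (Var i) = \<tau> (Var i) * mon M + of_nat (count M i) * mon (M - {#i#})"
proof (induction M)
  case (add j M)
  have "mon (add_mset j M) * \<tau> (Var i) =
      \<Delta> j * \<tau> (Var i) * mon M + of_nat (count M i) * (\<Delta> j * mon (M - {#i#}))"
    by (simp add: mult.assoc add distrib_left) (metis mult.assoc mult_of_nat_commute)
  also have "\<Delta> j * \<tau> (Var i) * mon M = \<tau> (Var i) * mon (add_mset j M) + (if i = j then mon M else 0)"
    by (simp add: \<Delta>_\<tau> distrib_right mult.assoc \<tau>_simps)
  \<comment> \<open>If \<open>i\<close> does not occur in \<open>M\<close>, removing it changes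
    nothing, but then the coefficient \<open>count M i\<close> is zero.\<close>
  also have "of_nat (count M i) * (\<Delta> j * mon (M - {#i#})) =
      of_nat (count M i) * mon (add_mset j M - (if i = j then {#j#} else {#i#}))"
  proof (cases "i = j \<or> i \<notin># M")
    case True
    then show ?thesis
    proof
      assume "i = j"
      show ?thesis
      proof (cases "i \<in># M")
        case True
        then have "mon M = \<Delta> i * mon (M - {#i#})"
          by (metis insert_DiffM mon_simps(2))
        with \<open>i = j\<close> show ?thesis by simp
      qed (simp add: not_in_iff)
    qed (simp add: not_in_iff)
  qed simp
  finally show ?case by (simp add: distrib_right)
qed simp

text \<open>Taking the commutator of a relation with \<open>\<tau> (Var i)\<close> kills the
  monomials without \<open>\<Delta> i\<close> and shortens the others. By induction on the size the
  new coefficients vanish; they are positive multiples of the old ones, so characteristic zero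
  leaves only the empty monomial, where \<open>\<tau>\<close> is injective.\<close>

lemma normal_form_unique:
  assumes "finite A" and "(\<Sum>M\<in>A. \<tau> (c M) * mon M) = 0" and "M \<in> A"
  shows "c M = 0"
proof -
  have "\<forall>M\<in>A. c M = 0"
    if "finite A" "\<forall>M\<in>A. size M < m" "(\<Sum>M\<in>A. \<tau> (c M) * mon M) = 0" for A c m
    using that
  proof (induction m arbitrary: A c)
    case (Suc m)
    let ?s = "\<Sum>M\<in>A. \<tau> (c M) * mon M"
    have nonempty: "c M = 0" if "M \<in> A" "i \<in># M" for M i
    proof -
      define A' where "A' = {M \<in> A. i \<in># M}"
      \<comment> \<open>The coefficient of \<open>mon N\<close> in the commutator. It comes from
        \<open>M = add_mset i N\<close>, where \<open>i\<close> occurs once more than in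
        \<open>N\<close>; hence the \<open>Suc\<close>.\<close>
      define d where "d N = c (add_mset i N) * of_nat (Suc (count N i))" for N
      have inj: "inj_on (\<lambda>M. M - {#i#}) A'"
        by (auto simp: A'_def inj_on_def) (metis insert_DiffM)
      have "0 = ?s * \<tau> (Var i) - \<tau> (Var i) * ?s" using Suc.prems by simp
      also have "\<dots> = (\<Sum>M\<in>A. \<tau> (c M) * of_nat (count M i) * mon (M - {#i#}))"
        unfolding sum_distrib_left sum_distrib_right sum_subtractf[symmetric]
      proof (rule sum.cong)
        fix M
        have "\<tau> (c M) * \<tau> (Var i) = \<tau> (Var i) * \<tau> (c M)"
          by (simp add: mult.commute flip: \<tau>_simps)
        then show "\<tau> (c M) * mon M * \<tau> (Var i) - \<tau> (Var i) * (\<tau> (c M) * mon M) =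
            \<tau> (c M) * of_nat (count M i) * mon (M - {#i#})"
          by (simp add: mult.assoc mon_Var distrib_left) (simp flip: mult.assoc)
      qed simp
      also have "\<dots> = (\<Sum>M\<in>A'. \<tau> (c M) * of_nat (count M i) * mon (M - {#i#}))"
        using Suc.prems(1) unfolding A'_def
        by (intro sum.mono_neutral_right) (auto simp: not_in_iff)
      also have "\<dots> = (\<Sum>M\<in>A'. \<tau> (d (M - {#i#})) * mon (M - {#i#}))"
        by (intro sum.cong) (auto simp: A'_def d_def \<tau>_simps \<tau>_of_nat simp del: of_nat_Suc)
      also have "\<dots> = (\<Sum>N\<in>(\<lambda>M. M - {#i#}) ` A'. \<tau> (d N) * mon N)"
        by (simp add: sum.reindex[OF inj])
      finally have "\<forall>N\<in>(\<lambda>M. M - {#i#}) ` A'. d N = 0"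
        using Suc.prems(1,2) by (intro Suc.IH) (auto simp: A'_def dest!: multi_member_split)
      then have "d (M - {#i#}) = 0" using that by (auto simp: A'_def)
      then show ?thesis using that by (auto simp: d_def count_eq_zero_iff simp del: of_nat_Suc)
    qed
    have "c {#} = 0" if "{#} \<in> A"
    proof -
      have "?s = (\<Sum>M\<in>{{#}}. \<tau> (c M) * mon M)"
      proof (rule sum.mono_neutral_right)
        have "c M = 0" if "M \<in> A" "M \<noteq> {#}" for M
          using that nonempty by (metis multiset_nonemptyE)
        then show "\<forall>M\<in>A - {{#}}. \<tau> (c M) * mon M = 0" by (simp add: \<tau>_simps)
      qed (use Suc.prems(1) that in auto)
      with Suc.prems(3) show ?thesis by (simp add: \<tau>_eq_0)
    qed
    with nonempty show ?case by (metis multiset_nonemptyE)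
  qed simp
  from this[OF assms(1) _ assms(2), of "Suc (Max (size ` A))"] assms show ?thesis
    by (simp add: le_imp_less_Suc)
qed

end

locale weyl_representation_pair =
  A: weyl_representation \<tau> \<Delta> + B: weyl_representation \<tau>' \<Delta>'
  for \<tau> :: "('n::linorder, 'k::field_char_0) mpoly \<Rightarrow> 'f::ring_1" and \<Delta> :: "'n \<Rightarrow> 'f"
    and \<tau>' :: "('n, 'k) mpoly \<Rightarrow> 'h::ring_1" and \<Delta>' :: "'n \<Rightarrow> 'h"
begin

text \<open>The graph of the homomorphism that maps \<^term>\<open>\<tau> p\<close> to \<^term>\<open>\<tau>' p\<close> and \<^term>\<open>\<Delta> i\<close> to
  \<^term>\<open>\<Delta>' i\<close>; it is single-valued because normal forms are unique.\<close>

inductive_set corr :: "('f \<times> 'h) set" where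
  single: "(\<tau> p * A.mon M, \<tau>' p * B.mon M) \<in> corr"
| add: "(a, b) \<in> corr \<Longrightarrow> (a', b') \<in> corr \<Longrightarrow> (a + a', b + b') \<in> corr"

lemma corr_\<tau>: "(\<tau> p, \<tau>' p) \<in> corr"
  using single[of p "{#}"] by simp

lemma corr_\<Delta>: "(\<Delta> i, \<Delta>' i) \<in> corr"
  using single[of 1 "{#i#}"] by (simp add: A.\<tau>_simps B.\<tau>_simps)

lemma corr_\<tau>_mult: "(a, b) \<in> corr \<Longrightarrow> (\<tau> p * a, \<tau>' p * b) \<in> corr"
proof (induction rule: corr.induct)
  case (single q M)
  show ?case using corr.single[of "p * q" M] by (simp add: A.\<tau>_simps B.\<tau>_simps mult.assoc)
qed (simp add: distrib_left add)

text \<open>Moving \<open>\<Delta> i\<close> past \<open>\<tau> q\<close> gives two terms in normal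
  form, and the correction \<open>partial i q\<close> is the same polynomial in both
  components.\<close>

lemma corr_\<Delta>_mult: "(a, b) \<in> corr \<Longrightarrow> (\<Delta> i * a, \<Delta>' i * b) \<in> corr"
proof (induction rule: corr.induct)
  case (single q M)
  show ?case
    using corr.add[OF corr.single[of q "add_mset i M"] corr.single[of "partial i q" M]]
    by (simp add: A.\<Delta>_\<tau> B.\<Delta>_\<tau> distrib_right flip: mult.assoc)
qed (simp add: distrib_left add)

lemma corr_mult:
  assumes "(a, b) \<in> corr" and "(a', b') \<in> corr"
  shows "(a * a', b * b') \<in> corr"
  using assms(1)
proof (induction rule: corr.induct)
  case (single p M)
  have "(A.mon M * a', B.mon M * b') \<in> corr"
    by (induction M) (use assms(2) corr_\<Delta>_mult in \<open>auto simp: mult.assoc\<close>)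
  then show ?case by (simp add: corr_\<tau>_mult mult.assoc)
qed (simp add: distrib_right add)

lemma corr_minus: "(a, b) \<in> corr \<Longrightarrow> (- a, - b) \<in> corr"
  using corr_\<tau>_mult[of a b "- 1"]
  by (simp add: A.\<tau>_simps B.\<tau>_simps ring_hom_on_diff[OF A.\<tau>_hom, of 0 1, simplified]
      ring_hom_on_diff[OF B.\<tau>_hom, of 0 1, simplified])

lemma corr_normal_form:
  assumes "(a, b) \<in> corr"
  shows "\<exists>A c. finite A \<and> a = (\<Sum>M\<in>A. \<tau> (c M) * A.mon M) \<and> b = (\<Sum>M\<in>A. \<tau>' (c M) * B.mon M)"
  using assms
proof (induction rule: corr.induct)
  case (single p M)
  show ?case by (intro exI[of _ "{M}"] exI[of _ "\<lambda>_. p"]) simp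
next
  case (add a b a' b')
  obtain A c where A: "finite A" "a = (\<Sum>M\<in>A. \<tau> (c M) * A.mon M)" "b = (\<Sum>M\<in>A. \<tau>' (c M) * B.mon M)"
    using add.IH(1) by blast
  obtain A' c' where A': "finite A'" "a' = (\<Sum>M\<in>A'. \<tau> (c' M) * A.mon M)"
      "b' = (\<Sum>M\<in>A'. \<tau>' (c' M) * B.mon M)"
    using add.IH(2) by blast
  let ?c = "\<lambda>M. if M \<in> A then c M else 0" and ?c' = "\<lambda>M. if M \<in> A' then c' M else 0"
  have "a = (\<Sum>M\<in>A \<union> A'. \<tau> (?c M) * A.mon M)" "b = (\<Sum>M\<in>A \<union> A'. \<tau>' (?c M) * B.mon M)"
    unfolding A(2,3) using A(1) A'(1)
    by (intro sum.mono_neutral_cong_left; auto simp: A.\<tau>_simps B.\<tau>_simps)+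
  moreover have "a' = (\<Sum>M\<in>A \<union> A'. \<tau> (?c' M) * A.mon M)" "b' = (\<Sum>M\<in>A \<union> A'. \<tau>' (?c' M) * B.mon M)"
    unfolding A'(2,3) using A(1) A'(1)
    by (intro sum.mono_neutral_cong_left; auto simp: A.\<tau>_simps B.\<tau>_simps)+
  ultimately have "a + a' = (\<Sum>M\<in>A \<union> A'. \<tau> (?c M + ?c' M) * A.mon M)"
      "b + b' = (\<Sum>M\<in>A \<union> A'. \<tau>' (?c M + ?c' M) * B.mon M)"
    by (simp_all only: A.\<tau>_simps B.\<tau>_simps distrib_right sum.distrib)
  then show ?case using A(1) A'(1)
    by (intro exI[of _ "A \<union> A'"] exI[of _ "\<lambda>M. ?c M + ?c' M"]) blast
qed

text \<open>Both components have the same coefficients, which vanish by uniqueness of normal forms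
  on either side. One direction makes the graph single-valued, the other makes the resulting map
  injective.\<close>

lemma corr_eq_0_iff:
  assumes "(a, b) \<in> corr"
  shows "a = 0 \<longleftrightarrow> b = 0"
proof -
  obtain A c where A: "finite A" "a = (\<Sum>M\<in>A. \<tau> (c M) * A.mon M)" "b = (\<Sum>M\<in>A. \<tau>' (c M) * B.mon M)"
    using corr_normal_form[OF assms] by blast
  have "c M = 0" if "M \<in> A" "a = 0 \<or> b = 0" for M
    using that A.normal_form_unique[OF A(1) _ that(1), of c] B.normal_form_unique[OF A(1) _ that(1), of c]
    by (auto simp: A(2,3))
  then have "a = 0 \<or> b = 0 \<Longrightarrow> \<forall>M\<in>A. c M = 0" by blast
  moreover have "a = 0 \<and> b = 0" if "\<forall>M\<in>A. c M = 0"
    unfolding A(2,3) using that by (auto simp: A.\<tau>_simps(4) B.\<tau>_simps(4) intro!: sum.neutral)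
  ultimately show ?thesis by blast
qed

lemma ring_hom_exists:
  assumes "S \<subseteq> Domain corr" and "unital_subring S"
  shows "\<exists>\<theta>. ring_hom_on S \<theta> \<and> (\<forall>s\<in>S. \<theta> s = 0 \<longrightarrow> s = 0) \<and>
    (\<forall>p. \<tau> p \<in> S \<longrightarrow> \<theta> (\<tau> p) = \<tau>' p) \<and> (\<forall>i. \<Delta> i \<in> S \<longrightarrow> \<theta> (\<Delta> i) = \<Delta>' i)"
proof -
  have unique: "b = b'" if "(a, b) \<in> corr" "(a, b') \<in> corr" for a b b'
    using corr_eq_0_iff[OF add[OF that(1) corr_minus[OF that(2)]]] by simp
  define \<theta> where "\<theta> s = (SOME b. (s, b) \<in> corr)" for s
  have \<theta>: "(s, \<theta> s) \<in> corr" if "s \<in> S" for s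
    unfolding \<theta>_def using that assms(1) by (intro someI_ex[of "\<lambda>b. (s, b) \<in> corr"]) auto
  note S = unital_subringD[OF assms(2)]
  have eq: "\<theta> a = b" if "a \<in> S" "(a, b) \<in> corr" for a b
    using unique[OF \<theta>] that by blast
  have "ring_hom_on S \<theta>"
    unfolding ring_hom_on_def
    using eq[OF S(1)] corr_\<tau>[of 1] by (auto simp: A.\<tau>_simps B.\<tau>_simps intro!: eq S add corr_mult \<theta>)
  moreover have "s = 0" if "s \<in> S" "\<theta> s = 0" for s
    using corr_eq_0_iff[OF \<theta>[OF that(1)]] that by simp
  ultimately show ?thesis using eq corr_\<tau> corr_\<Delta> by (intro exI[of _ \<theta>]) blast
qed

end

section \<open>The skew field of fractions of the Weyl algebra\<close>

lemma multiplication_in_weyl_algebra: "(\<lambda>q. p * q) \<in> weyl_algebra"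
proof (induction p rule: mpoly_induct)
  case (add p q)
  from weyl_algebra.add[OF this] show ?case by (simp add: distrib_right)
next
  case (mult p q)
  from weyl_algebra.mult[OF this] show ?case by (simp add: comp_def mult.assoc)
qed (rule scalar var)+

lemma sum_in_weyl_algebra:
  assumes "\<And>i. i \<in> A \<Longrightarrow> d i \<in> weyl_algebra"
  shows "(\<lambda>p. \<Sum>i\<in>A. d i p) \<in> weyl_algebra"
  using assms
proof (induction A rule: infinite_finite_induct)
  case (insert i A)
  then show ?case using weyl_algebra.add[of "d i" "\<lambda>p. \<Sum>i\<in>A. d i p"] by simp
qed (use multiplication_in_weyl_algebra[of 0] in simp_all)

text \<open>Serves for the conjugate of \<open>partial i\<close> by a group element, which is a
  derivation but in general no longer a single partial derivative.\<close>

lemma derivation_in_weyl_algebra: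
  fixes \<delta> :: "('n::finite, 'k::comm_ring_1) mpoly \<Rightarrow> ('n, 'k) mpoly"
  assumes "\<And>p q. \<delta> (p + q) = \<delta> p + \<delta> q" and "\<And>p q. \<delta> (p * q) = \<delta> p * q + p * \<delta> q"
    and "\<And>c. \<delta> (Const c) = 0"
  shows "\<delta> \<in> weyl_algebra"
proof -
  have "(\<lambda>p. \<Sum>i\<in>UNIV. ((\<lambda>q. \<delta> (Var i) * q) \<circ> partial i) p) \<in> weyl_algebra"
    by (intro sum_in_weyl_algebra weyl_algebra.mult multiplication_in_weyl_algebra weyl_algebra.partial)
  also have "(\<lambda>p. \<Sum>i\<in>UNIV. ((\<lambda>q. \<delta> (Var i) * q) \<circ> partial i) p) = \<delta>"
    by (rule ext) (simp flip: mpoly_derivation_eq[of \<delta>, OF assms])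
  finally show ?thesis .
qed

locale weyl_fractions =
  fixes \<iota> :: "('n::{finite,linorder}, 'k::field_char_0) operator \<Rightarrow> 'f::division_ring"
  assumes skew_field: "weyl_skew_field \<iota>"
begin

abbreviation W :: "'f set" where "W \<equiv> \<iota> ` weyl_algebra"

definition mul :: "('n, 'k) mpoly \<Rightarrow> 'f" where "mul p = \<iota> (\<lambda>q. p * q)"

definition der :: "'n \<Rightarrow> 'f" where "der i = \<iota> (partial i)"

lemma \<iota>_add: "d \<in> weyl_algebra \<Longrightarrow> e \<in> weyl_algebra \<Longrightarrow> \<iota> (\<lambda>p. d p + e p) = \<iota> d + \<iota> e"
  and \<iota>_mult: "d \<in> weyl_algebra \<Longrightarrow> e \<in> weyl_algebra \<Longrightarrow> \<iota> (d \<circ> e) = \<iota> d * \<iota> e"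
  and \<iota>_inj: "inj_on \<iota> weyl_algebra"
  and \<iota>_id: "\<iota> id = 1"
  using skew_field by (auto simp: weyl_skew_field_def)

lemma ring_hom_on_mul: "ring_hom_on UNIV mul"
  unfolding ring_hom_on_def
proof (intro conjI ballI)
  show "mul 1 = 1" using \<iota>_id by (simp add: mul_def id_def)
  fix p q
  show "mul (p + q) = mul p + mul q"
    using \<iota>_add[OF multiplication_in_weyl_algebra multiplication_in_weyl_algebra, of p q]
    by (simp add: mul_def distrib_right)
  show "mul (p * q) = mul p * mul q"
    using \<iota>_mult[OF multiplication_in_weyl_algebra multiplication_in_weyl_algebra, of p q]
    by (simp add: mul_def comp_def mult.assoc)
qed

lemmas mul_simps = ring_hom_onD[OF ring_hom_on_mul, simplified] ring_hom_on_zero[OF ring_hom_on_mul, simplified]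

lemma \<iota>_eq_0: "d \<in> weyl_algebra \<Longrightarrow> \<iota> d = 0 \<Longrightarrow> d = (\<lambda>_. 0)"
  using inj_onD[OF \<iota>_inj _ _ multiplication_in_weyl_algebra[of 0], of d] mul_simps(4)
  by (simp add: mul_def)

lemma mul_eq_0: "mul p = 0 \<Longrightarrow> p = 0"
  using \<iota>_eq_0[OF multiplication_in_weyl_algebra, of p] by (metis mul_def mult_1_right)

lemma W_induct [consumes 1, case_names mul der add mult]:
  assumes "w \<in> W" and "\<And>p. Q (mul p)" and "\<And>i. Q (der i)"
    and "\<And>v w. v \<in> W \<Longrightarrow> w \<in> W \<Longrightarrow> Q v \<Longrightarrow> Q w \<Longrightarrow> Q (v + w)"
    and "\<And>v w. v \<in> W \<Longrightarrow> w \<in> W \<Longrightarrow> Q v \<Longrightarrow> Q w \<Longrightarrow> Q (v * w)"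
  shows "Q w"
proof -
  obtain d where "d \<in> weyl_algebra" "w = \<iota> d" using assms(1) by blast
  moreover from this(1) have "Q (\<iota> d)"
  proof induction
    case (add d e)
    then show ?case using assms(4) by (simp add: \<iota>_add)
  next
    case (mult d e)
    then show ?case using assms(5) by (simp only: \<iota>_mult image_eqI)
  qed (use assms(2,3) in \<open>auto simp: mul_def der_def\<close>)
  ultimately show ?thesis by simp
qed

lemma mul_in_W: "mul p \<in> W" and der_in_W: "der i \<in> W"
  unfolding mul_def der_def by (auto intro: multiplication_in_weyl_algebra weyl_algebra.partial)

lemma der_commute: "der i * der j = der j * der i"
proof -
  have "partial i \<circ> partial j = (partial j \<circ> partial i :: ('n, 'k) operator)"
    by (simp add: fun_eq_iff partial_commute)
  then show ?thesis
    unfolding der_def by (metis \<iota>_mult weyl_algebra.partial)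
qed

lemma der_mul: "der i * mul p = mul p * der i + mul (partial i p)"
proof -
  have "der i * mul p = \<iota> (partial i \<circ> (\<lambda>q. p * q))"
    unfolding der_def mul_def by (simp add: \<iota>_mult weyl_algebra.partial multiplication_in_weyl_algebra)
  also have "partial i \<circ> (\<lambda>q. p * q) = (\<lambda>q. ((\<lambda>q. p * q) \<circ> partial i) q + partial i p * q)"
    by (simp add: fun_eq_iff partial_mult add.commute)
  also have "\<iota> \<dots> = mul p * der i + mul (partial i p)"
    unfolding der_def mul_def
    by (simp only: \<iota>_add \<iota>_mult weyl_algebra.mult weyl_algebra.partial multiplication_in_weyl_algebra)
  finally show ?thesis .
qed

sublocale weyl_representation mul der
  by standard (auto simp: der_mul intro: ring_hom_on_mul mul_eq_0 der_commute)

sublocale right_fractions W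
proof
  show "unital_subring W"
    unfolding unital_subring_def
  proof (intro conjI ballI)
    show "1 \<in> W" using mul_in_W[of 1] by (simp add: mul_simps)
    have mult: "v * w \<in> W" if "v \<in> W" "w \<in> W" for v w
      using that by (auto simp: \<iota>_mult[symmetric] intro: weyl_algebra.mult)
    fix v w assume "v \<in> W" "w \<in> W"
    then show "v * w \<in> W" by (rule mult)
    \<comment> \<open>The inductive definition has no clause for negatives; they arise as products
      with the constant \<open>- 1\<close>.\<close>
    have "mul (- 1) * w \<in> W" using mul_in_W \<open>w \<in> W\<close> by (rule mult)
    moreover have "mul (- 1) * w = - w"
      using ring_hom_on_diff[OF ring_hom_on_mul, of 0 1] by (simp add: mul_simps)
    ultimately obtain d e where "d \<in> weyl_algebra" "e \<in> weyl_algebra" "v = \<iota> d" "- w = \<iota> e"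
      using \<open>v \<in> W\<close> by auto
    then have "v + (- w) \<in> W"
      by (auto simp: \<iota>_add[symmetric] intro: weyl_algebra.add)
    then show "v - w \<in> W" by simp
  qed
  fix f
  obtain a b where "a \<in> weyl_algebra" "b \<in> weyl_algebra" "b \<noteq> (\<lambda>_. 0)" "f = \<iota> a * inverse (\<iota> b)"
    using skew_field unfolding weyl_skew_field_def by blast
  then show "\<exists>a\<in>W. \<exists>b\<in>W. b \<noteq> 0 \<and> f = a * inverse b" using \<iota>_eq_0 by blast
qed

text \<open>The embedding of the rational functions into the skew field as fractions of
  multiplication operators.\<close>

definition \<kappa> :: "('n, 'k) ratfun \<Rightarrow> 'f" where
  "\<kappa> = (SOME \<sigma>. ring_hom_on UNIV \<sigma> \<and> (\<forall>p. \<sigma> (to_fract p) = mul p))"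

lemma ring_hom_on_\<kappa>: "ring_hom_on UNIV \<kappa>" and \<kappa>_to_fract: "\<kappa> (to_fract p) = mul p"
  using someI_ex[OF fract_hom_extension[OF ring_hom_on_mul mul_eq_0]] unfolding \<kappa>_def by blast+

lemmas \<kappa>_simps = ring_hom_onD[OF ring_hom_on_\<kappa>, simplified] ring_hom_on_zero[OF ring_hom_on_\<kappa>, simplified]
  ring_hom_on_diff[OF ring_hom_on_\<kappa>, simplified] ring_hom_on_sum[OF ring_hom_on_\<kappa>, simplified]

lemma \<kappa>_eq_iff [simp]: "\<kappa> u = \<kappa> v \<longleftrightarrow> u = v"
  using ring_hom_inj[OF ring_hom_on_\<kappa>] by (auto dest: injD)

lemma \<kappa>_commute: "\<kappa> u * \<kappa> v = \<kappa> v * \<kappa> u"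
  by (simp add: mult.commute flip: \<kappa>_simps)

text \<open>The functions \<open>u\<close> with this property form a division subring: the
  commutator obeys the Leibniz rule, and with \<open>inverse u\<close> it equals minus the
  commutator with \<open>u\<close> multiplied by \<open>inverse u\<close> on both sides. Polynomials
  belong to it by \<open>der_mul\<close>.\<close>

lemma commutator_in_range: "der i * \<kappa> u - \<kappa> u * der i \<in> range \<kappa>"
proof -
  let ?S = "{u. der i * \<kappa> u - \<kappa> u * der i \<in> range \<kappa>}"
  have R: "division_subring (range \<kappa>)" by (rule division_subring_range[OF ring_hom_on_\<kappa>])
  note R' = unital_subringD[OF R[unfolded division_subring_def, THEN conjunct1]]
  have "division_subring ?S"
    unfolding division_subring_def unital_subring_def
  proof (intro conjI ballI)
    show "1 \<in> ?S" using R'(2) by (simp add: \<kappa>_simps)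
    fix u assume u: "u \<in> ?S"
    show "inverse u \<in> ?S"
    proof (cases "u = 0")
      case False
      then have nz: "\<kappa> u \<noteq> 0" by (simp flip: \<kappa>_simps(4))
      have "der i * inverse (\<kappa> u) - inverse (\<kappa> u) * der i =
          - (inverse (\<kappa> u) * (der i * \<kappa> u - \<kappa> u * der i) * inverse (\<kappa> u))"
        using nz by (simp add: left_diff_distrib right_diff_distrib mult.assoc)
          (simp flip: mult.assoc)
      also have "\<dots> \<in> range \<kappa>"
        using u R by (intro R'(4,6)) (auto simp only: division_subring_def)
      finally show ?thesis by (simp add: ring_hom_inverse[OF ring_hom_on_\<kappa>])
    qed (use R'(2) in \<open>simp add: \<kappa>_simps\<close>)
    fix v assume v: "v \<in> ?S"
    have "der i * \<kappa> (u - v) - \<kappa> (u - v) * der i = der i * \<kappa> u - \<kappa> u * der i - (der i * \<kappa> v - \<kappa> v * der i)"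
      by (simp add: \<kappa>_simps algebra_simps)
    also have "\<dots> \<in> range \<kappa>" using u v unfolding mem_Collect_eq by (rule R'(3))
    finally show "u - v \<in> ?S" by simp
    have "der i * \<kappa> (u * v) - \<kappa> (u * v) * der i =
        (der i * \<kappa> u - \<kappa> u * der i) * \<kappa> v + \<kappa> u * (der i * \<kappa> v - \<kappa> v * der i)"
      by (simp add: \<kappa>_simps algebra_simps)
    also have "\<dots> \<in> range \<kappa>" using u v by (intro R'(5,6)) auto
    finally show "u * v \<in> ?S" by simp
  qed
  moreover have "der i * \<kappa> (to_fract p) - \<kappa> (to_fract p) * der i = \<kappa> (to_fract (partial i p))" for p
    by (simp add: \<kappa>_to_fract der_mul)
  then have "range to_fract \<subseteq> ?S" by auto
  ultimately show ?thesis using fract_in_division_subring by blast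
qed

text \<open>The partial derivative of a rational function, read off from a commutator in the skew
  field; this avoids a quotient formula that would have to be shown independent of the
  representation.\<close>

definition D :: "'n \<Rightarrow> ('n, 'k) ratfun \<Rightarrow> ('n, 'k) ratfun" where
  "D i u = (THE v. \<kappa> v = der i * \<kappa> u - \<kappa> u * der i)"

lemma \<kappa>_D: "\<kappa> (D i u) = der i * \<kappa> u - \<kappa> u * der i"
proof -
  obtain v where "\<kappa> v = der i * \<kappa> u - \<kappa> u * der i" using commutator_in_range by (metis rangeE)
  moreover from this have "D i u = v"
    unfolding D_def by (rule the_equality) (metis \<kappa>_eq_iff calculation)
  ultimately show ?thesis by simp
qed

lemma derivation_D: "derivation (D i)"
  unfolding derivation_def
  by (intro allI conjI; subst \<kappa>_eq_iff[symmetric]; simp only: \<kappa>_D \<kappa>_simps)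
    (simp_all add: left_diff_distrib right_diff_distrib distrib_left distrib_right mult.assoc)

lemma D_to_fract: "D i (to_fract p) = to_fract (partial i p)"
  by (subst \<kappa>_eq_iff[symmetric]) (simp add: \<kappa>_D \<kappa>_to_fract der_mul)

lemma D_ratfun_const: "D i (ratfun_const c) = 0"
  by (simp add: ratfun_const_def D_to_fract)

lemma D_Var: "D i (to_fract (Var j)) = (if i = j then 1 else 0)"
  by (simp add: D_to_fract)

lemma D_combination_Var: "(\<Sum>i\<in>UNIV. c i * D i (to_fract (Var j))) = c j"
  by (simp add: D_Var if_distrib[of "\<lambda>x. _ * x"] sum.delta cong: if_cong)

lemma D_combination_derivation: "derivation (\<lambda>u. \<Sum>i\<in>UNIV. c i * D i u)"
  by (intro derivation_combination derivation_D)

lemma commutator_\<kappa>: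
  "(\<Sum>i\<in>UNIV. \<kappa> (c i) * der i) * \<kappa> u - \<kappa> u * (\<Sum>i\<in>UNIV. \<kappa> (c i) * der i) =
     \<kappa> (\<Sum>i\<in>UNIV. c i * D i u)"
proof -
  have "\<kappa> (c i) * der i * \<kappa> u - \<kappa> u * (\<kappa> (c i) * der i) = \<kappa> (c i * D i u)" for i
    by (simp add: \<kappa>_simps \<kappa>_D right_diff_distrib mult.assoc) (simp add: \<kappa>_commute flip: mult.assoc)
  then show ?thesis
    by (simp add: \<kappa>_simps sum_distrib_left sum_distrib_right flip: sum_subtractf)
qed

end

section \<open>The action of the group\<close>

locale noether_problem = weyl_fractions \<iota>
  for \<iota> :: "('n::{finite,linorder}, 'k::field_char_0) operator \<Rightarrow> 'f::division_ring" +
  fixes G :: "('g, 'm) monoid_scheme" (structure) and \<phi> :: "'g \<Rightarrow> ('n, 'k) operator"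
    and B :: "('n, 'k) ratfun set"
  assumes finite_G: "finite (carrier G)"
    and action: "group_action G UNIV \<phi>"
    and automorphism: "g \<in> carrier G \<Longrightarrow> poly_algebra_automorphism (\<phi> g)"
    and independent: "algebraically_independent ratfun_const B"
    and invariants: "ratfun_invariants G \<phi> = generate_field ring_of_type_algebra (range ratfun_const \<union> B)"
begin

sublocale group G
  using action by (simp add: group_action_def group_hom_def)

lemma \<phi>_one: "\<phi> \<one> p = p"
  using group_action.id_eq_one[OF action] by (metis UNIV_I restrict_apply')

lemma \<phi>_mult: "g \<in> carrier G \<Longrightarrow> h \<in> carrier G \<Longrightarrow> \<phi> (g \<otimes> h) p = \<phi> g (\<phi> h p)"
  using group_action.composition_rule[OF action] by blast

lemma \<phi>_inv: "g \<in> carrier G \<Longrightarrow> \<phi> g (\<phi> (inv g) p) = p" "g \<in> carrier G \<Longrightarrow> \<phi> (inv g) (\<phi> g p) = p"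
  by (simp_all flip: \<phi>_mult add: \<phi>_one)

lemma \<phi>_simps:
  assumes "g \<in> carrier G"
  shows "\<phi> g (p + q) = \<phi> g p + \<phi> g q" and "\<phi> g (p * q) = \<phi> g p * \<phi> g q"
    and "\<phi> g (Const c) = Const c"
  using automorphism[OF assms] by (simp_all add: poly_algebra_automorphism_def)

lemma ring_hom_on_\<phi>: "g \<in> carrier G \<Longrightarrow> ring_hom_on UNIV (\<phi> g)"
  using \<phi>_simps(3)[of g 1] by (simp add: ring_hom_on_def \<phi>_simps)

lemma weyl_action_multiplication:
  "g \<in> carrier G \<Longrightarrow> weyl_action G \<phi> g (\<lambda>q. p * q) = (\<lambda>q. \<phi> g p * q)"
  by (simp add: weyl_action_def fun_eq_iff \<phi>_simps \<phi>_inv)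

lemma weyl_action_add:
  "g \<in> carrier G \<Longrightarrow> weyl_action G \<phi> g (\<lambda>p. d p + e p) = (\<lambda>p. weyl_action G \<phi> g d p + weyl_action G \<phi> g e p)"
  by (simp add: weyl_action_def fun_eq_iff \<phi>_simps)

lemma weyl_action_mult:
  "g \<in> carrier G \<Longrightarrow> weyl_action G \<phi> g (d \<circ> e) = weyl_action G \<phi> g d \<circ> weyl_action G \<phi> g e"
  by (simp add: weyl_action_def fun_eq_iff \<phi>_inv)

lemma weyl_action_inv:
  "g \<in> carrier G \<Longrightarrow> weyl_action G \<phi> g (weyl_action G \<phi> (inv g) d) = d"
  "g \<in> carrier G \<Longrightarrow> weyl_action G \<phi> (inv g) (weyl_action G \<phi> g d) = d"
  by (simp_all add: weyl_action_def fun_eq_iff \<phi>_inv)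

lemma weyl_action_partial:
  fixes i :: 'n
  assumes g: "g \<in> carrier G"
  defines "\<delta> \<equiv> weyl_action G \<phi> g (partial i)"
  shows "\<delta> (p + q) = \<delta> p + \<delta> q" and "\<delta> (p * q) = \<delta> p * q + p * \<delta> q" and "\<delta> (Const c) = 0"
  using g \<phi>_simps(3)[OF g, of 0]
  by (simp_all add: \<delta>_def weyl_action_def \<phi>_simps partial_add partial_mult \<phi>_inv)

lemma weyl_action_closed:
  assumes "g \<in> carrier G" and "d \<in> weyl_algebra"
  shows "weyl_action G \<phi> g d \<in> weyl_algebra"
  using assms(2)
proof induction
  case (partial i)
  show ?case by (intro derivation_in_weyl_algebra weyl_action_partial assms(1))
next
  case (mult d e)
  then show ?case unfolding weyl_action_mult[OF assms(1)] by (intro weyl_algebra.mult)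
qed (auto simp: assms(1) weyl_action_multiplication weyl_action_add
    intro: multiplication_in_weyl_algebra weyl_algebra.add)

definition \<sigma> :: "'g \<Rightarrow> 'f \<Rightarrow> 'f" where
  "\<sigma> g = fraction_extension \<iota> weyl_algebra (weyl_action G \<phi> g)"

definition \<gamma> :: "'g \<Rightarrow> ('n, 'k) ratfun \<Rightarrow> ('n, 'k) ratfun" where
  "\<gamma> g = fraction_extension to_fract UNIV (\<phi> g)"

text \<open>The value of \<open>fraction_extension\<close> is a definite description, so an
  extension is constructed first. The one for \<open>inv g\<close> then serves as the inverse that
  proves bijectivity.\<close>

lemma \<sigma>: "g \<in> carrier G \<Longrightarrow> ring_hom_on UNIV (\<sigma> g)"
  and \<sigma>_\<iota>: "g \<in> carrier G \<Longrightarrow> d \<in> weyl_algebra \<Longrightarrow> \<sigma> g (\<iota> d) = \<iota> (weyl_action G \<phi> g d)"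
proof -
  have "\<exists>s. ring_hom_on UNIV s \<and> (\<forall>d\<in>weyl_algebra. s (\<iota> d) = \<iota> (weyl_action G \<phi> g d))"
    if g: "g \<in> carrier G" for g
  proof -
    define \<theta> where "\<theta> w = \<iota> (weyl_action G \<phi> g (inv_into weyl_algebra \<iota> w))" for w
    have \<theta>: "\<theta> (\<iota> d) = \<iota> (weyl_action G \<phi> g d)" if "d \<in> weyl_algebra" for d
      using that \<iota>_inj by (simp add: \<theta>_def)
    have "ring_hom_on W \<theta>"
      unfolding ring_hom_on_def
    proof (intro conjI ballI)
      have "\<theta> (mul p) = mul (\<phi> g p)" for p
        using g by (simp add: mul_def \<theta> multiplication_in_weyl_algebra weyl_action_multiplication)
      from this[of 1] show "\<theta> 1 = 1" using ring_hom_onD(1)[OF ring_hom_on_\<phi>[OF g]] by (simp add: mul_simps)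
      fix v w assume "v \<in> W" "w \<in> W"
      then obtain d e where d: "d \<in> weyl_algebra" "v = \<iota> d" and e: "e \<in> weyl_algebra" "w = \<iota> e"
        by blast
      note closed = weyl_action_closed[OF g d(1)] weyl_action_closed[OF g e(1)]
      show "\<theta> (v + w) = \<theta> v + \<theta> w"
        using \<theta>[OF weyl_algebra.add[OF d(1) e(1)]] closed
        by (simp add: d e \<theta> \<iota>_add weyl_action_add[OF g])
      show "\<theta> (v * w) = \<theta> v * \<theta> w"
        using \<theta>[OF weyl_algebra.mult[OF d(1) e(1)]] closed
        by (simp add: d e \<theta> \<iota>_mult weyl_action_mult[OF g])
    qed
    moreover have "w = 0" if w: "w \<in> W" and zero: "\<theta> w = 0" for w
    proof -
      obtain d where d: "d \<in> weyl_algebra" "w = \<iota> d" using w by blast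
      then have "weyl_action G \<phi> g d = (\<lambda>_. 0)"
        using zero \<theta> \<iota>_eq_0[OF weyl_action_closed[OF g]] by simp
      then have "d = weyl_action G \<phi> (inv g) (\<lambda>p. 0 * p)"
        using weyl_action_inv(2)[of g d] g by simp
      also have "\<dots> = (\<lambda>p. 0 * p)"
        using g weyl_action_multiplication[of "inv g" 0] ring_hom_on_zero[OF ring_hom_on_\<phi>, of "inv g"] by simp
      finally show ?thesis using mul_simps(4) by (simp add: d(2) mul_def)
    qed
    ultimately show ?thesis using ring_hom_extension[of \<theta>] \<theta> by (metis image_eqI)
  qed
  then obtain s where s: "\<And>g. g \<in> carrier G \<Longrightarrow> ring_hom_on UNIV (s g)"
    and ext: "\<And>g d. g \<in> carrier G \<Longrightarrow> d \<in> weyl_algebra \<Longrightarrow> s g (\<iota> d) = \<iota> (weyl_action G \<phi> g d)"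
    by metis
  have eq: "\<sigma> g = s g" if "g \<in> carrier G" for g
    unfolding \<sigma>_def using that
    by (intro fraction_extension_eq[where t = "s (inv g)" and f' = "weyl_action G \<phi> (inv g)"]
        right_fractions_axioms s ext weyl_action_closed weyl_action_inv inv_closed)
  show "g \<in> carrier G \<Longrightarrow> ring_hom_on UNIV (\<sigma> g)"
    and "g \<in> carrier G \<Longrightarrow> d \<in> weyl_algebra \<Longrightarrow> \<sigma> g (\<iota> d) = \<iota> (weyl_action G \<phi> g d)"
    using eq s ext by auto
qed

lemma \<gamma>: "g \<in> carrier G \<Longrightarrow> ring_hom_on UNIV (\<gamma> g)"
  and \<gamma>_to_fract: "g \<in> carrier G \<Longrightarrow> \<gamma> g (to_fract p) = to_fract (\<phi> g p)"
proof -
  have "\<exists>s. ring_hom_on UNIV s \<and> (\<forall>p. s (to_fract p) = to_fract (\<phi> g p))" if g: "g \<in> carrier G" for g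
  proof (rule fract_hom_extension)
    show "ring_hom_on UNIV (\<lambda>p. to_fract (\<phi> g p))"
      by (rule ring_hom_on_compose[OF ring_hom_on_to_fract ring_hom_on_\<phi>[OF g]])
    fix p assume "to_fract (\<phi> g p) = 0"
    then have "\<phi> (inv g) (\<phi> g p) = \<phi> (inv g) 0" by simp
    then show "p = 0" using g ring_hom_on_zero[OF ring_hom_on_\<phi>, of "inv g"] by (simp add: \<phi>_inv)
  qed
  then obtain s where s: "\<And>g. g \<in> carrier G \<Longrightarrow> ring_hom_on UNIV (s g)"
    and ext: "\<And>g p. g \<in> carrier G \<Longrightarrow> s g (to_fract p) = to_fract (\<phi> g p)"
    by metis
  have eq: "\<gamma> g = s g" if "g \<in> carrier G" for g
    unfolding \<gamma>_def using that
    by (intro fraction_extension_eq[where t = "s (inv g)" and f' = "\<phi> (inv g)"]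
        right_fractions_to_fract s ext \<phi>_inv UNIV_I inv_closed)
  show "g \<in> carrier G \<Longrightarrow> ring_hom_on UNIV (\<gamma> g)"
    and "g \<in> carrier G \<Longrightarrow> \<gamma> g (to_fract p) = to_fract (\<phi> g p)"
    using eq s ext by auto
qed

sublocale K: finite_group_on_field G \<gamma>
proof
  have "\<gamma> \<one> = (\<lambda>u. u)"
    by (intro fract_hom_eqI \<gamma>) (auto simp: \<gamma>_to_fract \<phi>_one ring_hom_on_def)
  then show "\<gamma> \<one> u = u" for u by simp
  fix g h assume gh: "g \<in> carrier G" "h \<in> carrier G"
  then have "\<gamma> (g \<otimes> h) = (\<lambda>u. \<gamma> g (\<gamma> h u))"
    by (intro fract_hom_eqI[OF _ ring_hom_on_compose[OF \<gamma>[of g] \<gamma>[of h]]] \<gamma>)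
      (simp_all add: \<gamma>_to_fract \<phi>_mult)
  then show "\<gamma> (g \<otimes> h) u = \<gamma> g (\<gamma> h u)" for u by simp
qed (simp_all add: finite_G \<gamma>)

lemma fixed_eq: "K.fixed = generate_field ring_of_type_algebra (range ratfun_const \<union> B)"
  by (simp add: K.fixed_def \<gamma>_def ratfun_invariants_def flip: invariants)

lemma B_fixed: "b \<in> B \<Longrightarrow> g \<in> carrier G \<Longrightarrow> \<gamma> g b = b"
  using fixed_eq generate_field.incl[of b "range ratfun_const \<union> B"] by (auto simp: K.fixed_def)

lemma \<sigma>_\<kappa>:
  assumes "g \<in> carrier G"
  shows "\<sigma> g (\<kappa> u) = \<kappa> (\<gamma> g u)"
proof -
  have "(\<lambda>u. \<sigma> g (\<kappa> u)) = (\<lambda>u. \<kappa> (\<gamma> g u))"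
    using assms
    by (intro fract_hom_eqI[OF ring_hom_on_compose[OF \<sigma>[of g] ring_hom_on_\<kappa>]
          ring_hom_on_compose[OF ring_hom_on_\<kappa> \<gamma>[of g]]])
      (simp_all add: \<kappa>_to_fract \<gamma>_to_fract mul_def \<sigma>_\<iota> multiplication_in_weyl_algebra weyl_action_multiplication)
  then show ?thesis by (rule fun_cong)
qed


section \<open>Partial derivatives with respect to a transcendence basis\<close>

lemma derivation_eq_0_if_basis:
  assumes "derivation \<delta>" and "\<And>c. \<delta> (ratfun_const c) = 0" and "\<And>b. b \<in> B \<Longrightarrow> \<delta> b = 0"
  shows "\<delta> u = 0"
proof (rule K.derivation_eq_0[OF assms(1)])
  have "K.fixed \<subseteq> {u. \<delta> u = 0}"
    unfolding fixed_eq using assms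
    by (intro generate_field_subset division_subring_derivation_kernel) auto
  then show "\<delta> l = 0" if "l \<in> K.fixed" for l using that by blast
qed

text \<open>The combination is a derivation of the rational functions that vanishes on constants and
  on \<open>B\<close>, hence is zero; its value at the variable \<open>j\<close> is
  \<open>c j\<close>. In matrix terms the Jacobian has trivial kernel.\<close>

lemma combination_eq_0:
  assumes "\<And>b. b \<in> B \<Longrightarrow> (\<Sum>i\<in>UNIV. c i * D i b) = 0"
  shows "c j = 0"
  using derivation_eq_0_if_basis[OF D_combination_derivation, of c "to_fract (Var j)"] assms
  by (simp add: D_combination_Var D_ratfun_const)

text \<open>The upper bound is the one for independent elements. With fewer than \<open>n\<close>
  elements, the conditions that a combination of the \<open>D i\<close> vanish on \<open>B\<close>
  would be fewer than its coefficients, against \<open>combination_eq_0\<close>.\<close>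

lemma card_B: "finite B" "card B = card (UNIV :: 'n set)"
proof -
  show fin: "finite B"
  proof (rule ccontr)
    assume "infinite B"
    then obtain C where "finite C" "card C = card (UNIV :: 'n set) + 1" "C \<subseteq> B"
      by (metis infinite_arbitrarily_large)
    with card_algebraically_independent_le[OF independent] show False by force
  qed
  have "\<not> card B < card (UNIV :: 'n set)"
  proof
    assume "card B < card (UNIV :: 'n set)"
    then obtain c where "\<exists>i. c i \<noteq> 0" "\<forall>b\<in>B. (\<Sum>i\<in>UNIV. D i b * c i) = 0"
      using homogeneous_system_nontrivial_solution[OF fin, of "UNIV :: 'n set" "\<lambda>b i. D i b"] by auto
    with combination_eq_0[of c] show False by (simp add: mult.commute)
  qed
  moreover have "card B \<le> card (UNIV :: 'n set)"
    using card_algebraically_independent_le[OF independent fin] by simp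
  ultimately show "card B = card (UNIV :: 'n set)" by simp
qed

definition y :: "'n \<Rightarrow> ('n, 'k) ratfun" where
  "y = (SOME y. bij_betw y UNIV B)"

lemma bij_y: "bij_betw y UNIV B"
  unfolding y_def using someI_ex[OF finite_same_card_bij[of "UNIV :: 'n set" B]] card_B by simp

lemma y_in_B: "y i \<in> B" and inj_y: "inj y" and range_y: "range y = B"
  using bij_y by (auto simp: bij_betw_def)

lemma B_cases:
  assumes "b \<in> B"
  obtains l where "b = y l"
proof -
  have "b \<in> range y" unfolding range_y by (rule assms)
  then show thesis using that by (rule rangeE)
qed

text \<open>The right-hand side is absorbed as an additional unknown \<open>None\<close>, so there
  are \<open>n\<close> equations in \<open>n + 1\<close> unknowns. In a nonzero solution
  \<open>c None\<close> cannot be 0 by \<open>combination_eq_0\<close>, and dividing by it solves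
  the inhomogeneous system.\<close>

lemma jacobian_inverse: "\<exists>c. \<forall>l. (\<Sum>j\<in>UNIV. c j * D j (y l)) = (if i = l then 1 else 0)"
proof -
  let ?a = "\<lambda>l. case_option (- (if i = l then 1 else 0)) (\<lambda>j. D j (y l))"
  have sum: "(\<Sum>x\<in>UNIV. f x) = f None + (\<Sum>j\<in>UNIV. f (Some j))"
    for f :: "'n option \<Rightarrow> ('n, 'k) ratfun"
    by (simp add: UNIV_option_conv sum.reindex)
  have "card (UNIV :: 'n set) < card (UNIV :: 'n option set)"
    by (simp add: UNIV_option_conv card_image)
  then obtain c where nz: "\<exists>x. c x \<noteq> 0" and "\<And>l. (\<Sum>x\<in>UNIV. ?a l x * c x) = 0"
    using homogeneous_system_nontrivial_solution[of "UNIV :: 'n set" "UNIV :: 'n option set" ?a] by auto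
  then have c: "(\<Sum>j\<in>UNIV. D j (y l) * c (Some j)) = (if i = l then c None else 0)" for l
    unfolding sum by (auto simp: algebra_simps split: if_splits)
  have "c None \<noteq> 0"
  proof
    assume "c None = 0"
    have "(\<Sum>j\<in>UNIV. c (Some j) * D j b) = 0" if b: "b \<in> B" for b
    proof -
      from b obtain l where "b = y l" by (rule B_cases)
      then show ?thesis using c[of l] \<open>c None = 0\<close> by (simp add: mult.commute)
    qed
    then have "c (Some j) = 0" for j by (rule combination_eq_0)
    with \<open>c None = 0\<close> nz show False by (metis option.exhaust)
  qed
  then have "(\<Sum>j\<in>UNIV. (inverse (c None) * c (Some j)) * D j (y l)) = (if i = l then 1 else 0)" for l
    using c[of l] by (simp add: mult.assoc mult.commute[of "c (Some _)"] flip: sum_distrib_left)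
  then show ?thesis by (intro exI[of _ "\<lambda>j. inverse (c None) * c (Some j)"]) blast
qed

text \<open>Row \<open>i\<close> of the inverse of the Jacobian matrix of \<open>y\<close>.\<close>

definition J :: "'n \<Rightarrow> 'n \<Rightarrow> ('n, 'k) ratfun" where
  "J i = (SOME c. \<forall>l. (\<Sum>j\<in>UNIV. c j * D j (y l)) = (if i = l then 1 else 0))"

definition \<delta> :: "'n \<Rightarrow> ('n, 'k) ratfun \<Rightarrow> ('n, 'k) ratfun" where
  "\<delta> i u = (\<Sum>j\<in>UNIV. J i j * D j u)"

definition \<Delta> :: "'n \<Rightarrow> 'f" where
  "\<Delta> i = (\<Sum>j\<in>UNIV. \<kappa> (J i j) * der j)"

lemma \<delta>_y: "\<delta> i (y l) = (if i = l then 1 else 0)"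
  unfolding \<delta>_def J_def using someI_ex[OF jacobian_inverse] by blast

lemma derivation_\<delta>: "derivation (\<delta> i)"
  unfolding \<delta>_def by (rule D_combination_derivation)

lemma \<delta>_ratfun_const: "\<delta> i (ratfun_const c) = 0"
  by (simp add: \<delta>_def D_ratfun_const)

lemma \<Delta>_\<kappa>: "\<Delta> i * \<kappa> u = \<kappa> u * \<Delta> i + \<kappa> (\<delta> i u)"
  using commutator_\<kappa>[of "J i" u] by (simp add: \<Delta>_def \<delta>_def algebra_simps)

text \<open>The commutator of such a sum with \<open>\<kappa> b\<close> is the value at
  \<open>b\<close> of the derivation with the same coefficients, and these values on
  \<open>B\<close> determine the coefficients.\<close>

lemma first_order_eqI:
  assumes "\<And>b. b \<in> B \<Longrightarrow>
    (\<Sum>l\<in>UNIV. \<kappa> (v l) * der l) * \<kappa> b - \<kappa> b * (\<Sum>l\<in>UNIV. \<kappa> (v l) * der l) =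
    (\<Sum>l\<in>UNIV. \<kappa> (w l) * der l) * \<kappa> b - \<kappa> b * (\<Sum>l\<in>UNIV. \<kappa> (w l) * der l)"
  shows "v = w"
proof
  fix j
  have "(\<Sum>i\<in>UNIV. (v i - w i) * D i b) = 0" if "b \<in> B" for b
    using assms[OF that] unfolding commutator_\<kappa>
    by (simp add: left_diff_distrib sum_subtractf)
  from combination_eq_0[OF this] show "v j = w j" by simp
qed

text \<open>The second order parts of the two products cancel, so the commutator is of first order.
  Its commutators with the basis vanish because each \<open>\<delta> i (y l)\<close> is 0 or 1, and
  \<open>first_order_eqI\<close> applies.\<close>

lemma \<Delta>_\<Delta>_commute: "\<Delta> i * \<Delta> j = \<Delta> j * \<Delta> i"
proof -
  \<comment> \<open>Second order part \<open>?Q\<close> and first order part \<open>?T\<close> of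
    \<open>\<Delta> i * \<Delta> j\<close>, with coefficients moved to the left.\<close>
  let ?Q = "\<lambda>i j. \<Sum>l\<in>UNIV. \<Sum>m\<in>UNIV. \<kappa> (J j l) * \<kappa> (J i m) * (der m * der l)"
  let ?T = "\<lambda>i j. \<Sum>l\<in>UNIV. \<kappa> (\<delta> i (J j l)) * der l"
  have prod: "\<Delta> i * \<Delta> j = ?Q i j + ?T i j" for i j
  proof -
    have "\<Delta> i * \<Delta> j = (\<Sum>l\<in>UNIV. \<Delta> i * \<kappa> (J j l) * der l)"
      by (simp add: \<Delta>_def[of j] sum_distrib_left mult.assoc)
    also have "\<dots> = (\<Sum>l\<in>UNIV. \<kappa> (J j l) * \<Delta> i * der l) + ?T i j"
      by (simp add: \<Delta>_\<kappa> distrib_right sum.distrib)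
    also have "(\<Sum>l\<in>UNIV. \<kappa> (J j l) * \<Delta> i * der l) = ?Q i j"
      by (simp add: \<Delta>_def sum_distrib_left sum_distrib_right mult.assoc)
    finally show ?thesis .
  qed
  have Q: "?Q i j = ?Q j i"
    by (subst sum.swap) (simp add: \<kappa>_commute der_commute)
  have jacobi: "(\<Delta> i * \<Delta> j - \<Delta> j * \<Delta> i) * \<kappa> b - \<kappa> b * (\<Delta> i * \<Delta> j - \<Delta> j * \<Delta> i) = 0"
    if "b \<in> B" for b
  proof -
    from \<open>b \<in> B\<close> obtain l where b: "b = y l" by (rule B_cases)
    have *: "\<Delta> i * \<Delta> j * \<kappa> b = \<kappa> b * \<Delta> i * \<Delta> j + (if i = l then \<Delta> j else 0) + (if j = l then \<Delta> i else 0)"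
      for i j
      by (simp add: mult.assoc \<Delta>_\<kappa> b \<delta>_y distrib_left distrib_right \<kappa>_simps)
        (simp add: mult.assoc[symmetric] \<Delta>_\<kappa> \<delta>_y distrib_right \<kappa>_simps derivationD[OF derivation_\<delta>])
    show ?thesis unfolding left_diff_distrib * by (simp add: right_diff_distrib mult.assoc)
  qed
  have T: "\<Delta> i * \<Delta> j - \<Delta> j * \<Delta> i = ?T i j - ?T j i"
    by (simp add: prod Q)
  have "(\<lambda>l. \<delta> i (J j l)) = (\<lambda>l. \<delta> j (J i l))"
  proof (rule first_order_eqI)
    fix b assume "b \<in> B"
    from jacobi[OF this, unfolded T]
    show "?T i j * \<kappa> b - \<kappa> b * ?T i j = ?T j i * \<kappa> b - \<kappa> b * ?T j i"
      by (simp add: algebra_simps)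
  qed
  then have "?T i j = ?T j i" by (metis (no_types))
  with T show ?thesis by simp
qed

text \<open>The conjugate of \<open>partial j\<close> is a derivation of polynomials, so its values
  at the variables are its coefficients.\<close>

lemma \<sigma>_der: "g \<in> carrier G \<Longrightarrow> \<sigma> g (der j) = (\<Sum>l\<in>UNIV. mul (weyl_action G \<phi> g (partial j) (Var l)) * der l)"
proof -
  assume g: "g \<in> carrier G"
  let ?\<epsilon> = "weyl_action G \<phi> g (partial j)"
  have sum: "\<iota> (\<lambda>p. \<Sum>l\<in>A. c l * partial l p) = (\<Sum>l\<in>A. mul (c l) * der l)"
    if "finite A" for A and c :: "'n \<Rightarrow> ('n, 'k) mpoly"
    using that
  proof induction
    case empty
    show ?case using mul_simps(4) by (simp add: mul_def)
  next
    case (insert l A)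
    have "(\<lambda>p. c l * partial l p) \<in> weyl_algebra" "\<iota> (\<lambda>p. c l * partial l p) = mul (c l) * der l" for l
      using weyl_algebra.mult[OF multiplication_in_weyl_algebra weyl_algebra.partial, of "c l" l]
        \<iota>_mult[OF multiplication_in_weyl_algebra weyl_algebra.partial, of "c l" l]
      by (simp_all add: comp_def mul_def der_def)
    with insert show ?case
      using \<iota>_add[of "\<lambda>p. c l * partial l p" "\<lambda>p. \<Sum>l\<in>A. c l * partial l p"]
      by (simp add: sum_in_weyl_algebra)
  qed
  have "(\<lambda>p. \<Sum>l\<in>UNIV. ?\<epsilon> (Var l) * partial l p) = ?\<epsilon>"
    by (rule ext, rule mpoly_derivation_eq[symmetric]) (rule weyl_action_partial[OF g])+
  moreover have "\<sigma> g (der j) = \<iota> ?\<epsilon>"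
    unfolding der_def by (intro \<sigma>_\<iota> g weyl_algebra.partial)
  ultimately show ?thesis
    using sum[of UNIV "\<lambda>l. ?\<epsilon> (Var l)"] by simp
qed

text \<open>The image is again of first order by \<open>\<sigma>_der\<close>. Since
  \<open>\<sigma> g\<close> fixes the basis as well as 0 and 1, its commutators with the basis are
  those of \<open>\<Delta> i\<close>.\<close>

lemma \<sigma>_\<Delta>:
  assumes g: "g \<in> carrier G"
  shows "\<sigma> g (\<Delta> i) = \<Delta> i"
proof -
  define p where "p j l = to_fract (weyl_action G \<phi> g (partial j) (Var l))" for j l
  define w where "w l = (\<Sum>j\<in>UNIV. \<gamma> g (J i j) * p j l)" for l
  note hom = \<sigma>[OF g]
  have "\<sigma> g (\<Delta> i) = (\<Sum>j\<in>UNIV. \<Sum>l\<in>UNIV. \<kappa> (\<gamma> g (J i j) * p j l) * der l)"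
    by (simp add: \<Delta>_def ring_hom_on_sum[OF hom] ring_hom_onD[OF hom] \<sigma>_\<kappa>[OF g] \<sigma>_der[OF g]
        sum_distrib_left \<kappa>_simps p_def \<kappa>_to_fract mult.assoc)
  also have "\<dots> = (\<Sum>l\<in>UNIV. \<kappa> (w l) * der l)"
    by (subst sum.swap) (simp add: w_def \<kappa>_simps sum_distrib_right)
  finally have \<sigma>: "\<sigma> g (\<Delta> i) = (\<Sum>l\<in>UNIV. \<kappa> (w l) * der l)" .
  have "w = J i"
  proof (rule first_order_eqI)
    fix b assume "b \<in> B"
    then obtain l where l: "b = y l" by (rule B_cases)
    have "\<sigma> g (\<Delta> i) * \<kappa> b - \<kappa> b * \<sigma> g (\<Delta> i) = \<sigma> g (\<Delta> i * \<kappa> b - \<kappa> b * \<Delta> i)"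
      using B_fixed[OF \<open>b \<in> B\<close> g]
      by (simp add: ring_hom_on_diff[OF hom] ring_hom_onD[OF hom] \<sigma>_\<kappa>[OF g])
    also have "\<dots> = \<Delta> i * \<kappa> b - \<kappa> b * \<Delta> i"
      by (simp add: \<Delta>_\<kappa> l \<delta>_y \<kappa>_simps ring_hom_onD[OF hom] ring_hom_on_zero[OF hom])
    finally show "(\<Sum>l\<in>UNIV. \<kappa> (w l) * der l) * \<kappa> b - \<kappa> b * (\<Sum>l\<in>UNIV. \<kappa> (w l) * der l) =
        (\<Sum>l\<in>UNIV. \<kappa> (J i l) * der l) * \<kappa> b - \<kappa> b * (\<Sum>l\<in>UNIV. \<kappa> (J i l) * der l)"
      unfolding \<sigma>[symmetric] \<Delta>_def[symmetric] .
  qed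
  with \<sigma> show ?thesis by (simp add: \<Delta>_def)
qed

text \<open>The chain rule. By construction \<open>J\<close> is a left inverse of the matrix
  \<open>D j (y l)\<close>; being a right inverse is what is needed here, and it follows by testing
  on \<open>B\<close>.\<close>

lemma der_eq: "der j = (\<Sum>i\<in>UNIV. \<kappa> (D j (y i)) * \<Delta> i)"
proof -
  define w where "w l = (\<Sum>i\<in>UNIV. D j (y i) * J i l)" for l
  have sum: "(\<Sum>i\<in>UNIV. \<kappa> (D j (y i)) * \<Delta> i) = (\<Sum>l\<in>UNIV. \<kappa> (w l) * der l)"
    unfolding \<Delta>_def sum_distrib_left
    by (subst sum.swap) (simp add: w_def \<kappa>_simps sum_distrib_right mult.assoc)
  have "(if l = j then 1 else 0) - w l = 0" for l
  proof (rule combination_eq_0)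
    fix b assume "b \<in> B"
    then obtain k where k: "b = y k" by (rule B_cases)
    have "(\<Sum>l\<in>UNIV. w l * D l b) = (\<Sum>i\<in>UNIV. D j (y i) * \<delta> i b)"
      unfolding w_def \<delta>_def sum_distrib_left sum_distrib_right
      by (subst sum.swap) (simp add: mult.assoc)
    also have "\<dots> = D j b"
      by (simp add: k \<delta>_y if_distrib[of "\<lambda>x. _ * x"] sum.delta cong: if_cong)
    finally show "(\<Sum>l\<in>UNIV. ((if l = j then 1 else 0) - w l) * D l b) = 0"
      by (simp add: left_diff_distrib sum_subtractf if_distrib[of "\<lambda>x. x * _"] sum.delta cong: if_cong)
  qed
  then have "w = (\<lambda>l. if l = j then 1 else 0)" by (simp add: fun_eq_iff)
  then show ?thesis
    unfolding sum
    by (simp add: if_distrib[of \<kappa>] if_distrib[of "\<lambda>x. x * _"] \<kappa>_simps sum.delta cong: if_cong)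
qed

end

context noether_problem
begin

section \<open>The endomorphism onto the invariants\<close>

definition \<tau> :: "('n, 'k) mpoly \<Rightarrow> 'f" where
  "\<tau> p = \<kappa> (poly_eval ratfun_const y p)"

lemma ratfun_const_simps: "ratfun_const 0 = 0" "ratfun_const 1 = 1"
  by (simp_all add: ratfun_const_def)

lemma ring_hom_on_eval_y: "ring_hom_on UNIV (poly_eval ratfun_const y)"
  by (rule ring_hom_on_poly_eval[OF ring_hom_on_ratfun_const])

lemma \<delta>_eval_y: "\<delta> i (poly_eval ratfun_const y p) = poly_eval ratfun_const y (partial i p)"
proof -
  note eval = ring_hom_onD[OF ring_hom_on_eval_y, simplified] ring_hom_on_zero[OF ring_hom_on_eval_y, simplified]
  note basic = poly_eval_Const[where s = ratfun_const, OF ratfun_const_simps(1)]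
    poly_eval_Var[where s = ratfun_const, OF ratfun_const_simps]
  show ?thesis
  proof (induction p rule: mpoly_induct)
    case (Const c)
    show ?case by (simp add: basic \<delta>_ratfun_const eval)
  next
    case (Var j)
    show ?case by (simp add: basic \<delta>_y eval)
  next
    case (add p q)
    then show ?case by (simp add: eval partial_add derivationD[OF derivation_\<delta>])
  next
    case (mult p q)
    then show ?case by (simp add: eval partial_mult derivationD[OF derivation_\<delta>])
  qed
qed

text \<open>Injectivity of \<open>\<tau>\<close> is where the algebraic independence of the whole
  family \<open>y\<close> enters.\<close>

sublocale weyl_representation_pair mul der \<tau> \<Delta>
proof
  show "ring_hom_on UNIV \<tau>"
    unfolding \<tau>_def by (rule ring_hom_on_compose[OF ring_hom_on_\<kappa> ring_hom_on_eval_y])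
  fix p i j
  show "p = 0" if "\<tau> p = 0"
  proof -
    have "\<kappa> (poly_eval ratfun_const y p) = \<kappa> 0" using that by (simp add: \<tau>_def \<kappa>_simps)
    then have "poly_eval ratfun_const y p = 0" by (simp only: \<kappa>_eq_iff)
    then show ?thesis
      using poly_eval_eq_0_iff_of_independent[OF independent ratfun_const_simps(1) inj_y] range_y by simp
  qed
  show "\<Delta> i * \<Delta> j = \<Delta> j * \<Delta> i" by (rule \<Delta>_\<Delta>_commute)
  show "\<Delta> i * \<tau> p = \<tau> p * \<Delta> i + \<tau> (partial i p)"
    by (simp add: \<tau>_def \<Delta>_\<kappa> \<delta>_eval_y)
qed

lemma W_subset_Domain_corr: "W \<subseteq> Domain corr"
proof
  fix w assume "w \<in> W"
  then show "w \<in> Domain corr"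
  proof (induction w rule: W_induct)
    case (mul p)
    show ?case using corr_\<tau> by blast
  next
    case (der i)
    show ?case using corr_\<Delta> by blast
  next
    case (add v w)
    then show ?case using corr.add by blast
  next
    case (mult v w)
    then show ?case using corr_mult by blast
  qed
qed

definition \<Psi> :: "'f \<Rightarrow> 'f" where
  "\<Psi> = (SOME \<psi>. ring_hom_on UNIV \<psi> \<and> (\<forall>p. \<psi> (mul p) = \<tau> p) \<and> (\<forall>i. \<psi> (der i) = \<Delta> i))"

lemma ring_hom_on_\<Psi>: "ring_hom_on UNIV \<Psi>" and \<Psi>_mul: "\<Psi> (mul p) = \<tau> p" and \<Psi>_der: "\<Psi> (der i) = \<Delta> i"
proof -
  from ring_hom_exists[OF W_subset_Domain_corr subring]
  obtain \<theta> where \<theta>: "ring_hom_on W \<theta>" "\<forall>w\<in>W. \<theta> w = 0 \<longrightarrow> w = 0"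
    and "\<forall>p. mul p \<in> W \<longrightarrow> \<theta> (mul p) = \<tau> p" "\<forall>i. der i \<in> W \<longrightarrow> \<theta> (der i) = \<Delta> i"
    by (elim exE conjE)
  moreover have "\<exists>\<psi>. ring_hom_on UNIV \<psi> \<and> (\<forall>w\<in>W. \<psi> w = \<theta> w)"
    by (rule ring_hom_extension[OF \<theta>(1)]) (rule \<theta>(2)[rule_format])
  ultimately have "\<exists>\<psi>. ring_hom_on UNIV \<psi> \<and> (\<forall>p. \<psi> (mul p) = \<tau> p) \<and> (\<forall>i. \<psi> (der i) = \<Delta> i)"
    using mul_in_W der_in_W by metis
  from someI_ex[OF this]
  show "ring_hom_on UNIV \<Psi>" "\<Psi> (mul p) = \<tau> p" "\<Psi> (der i) = \<Delta> i"
    unfolding \<Psi>_def by blast+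
qed

lemmas \<Psi>_simps = ring_hom_onD[OF ring_hom_on_\<Psi>, simplified] ring_hom_on_zero[OF ring_hom_on_\<Psi>, simplified]
  ring_hom_on_diff[OF ring_hom_on_\<Psi>, simplified] ring_hom_on_sum[OF ring_hom_on_\<Psi>, simplified]

lemma division_subring_range_\<Psi>: "division_subring (range \<Psi>)"
  by (rule division_subring_range[OF ring_hom_on_\<Psi>])

lemmas range_\<Psi>_closed = unital_subringD[OF division_subring_range_\<Psi>[unfolded division_subring_def, THEN conjunct1]]

lemma \<kappa>_ratfun_const: "\<kappa> (ratfun_const c) = \<Psi> (mul (Const c))"
  by (simp add: \<Psi>_mul \<tau>_def poly_eval_Const ratfun_const_simps)

lemma \<kappa>_y: "\<kappa> (y i) = \<Psi> (mul (Var i))"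
  by (simp add: \<Psi>_mul \<tau>_def poly_eval_Var ratfun_const_simps)

lemma \<kappa>_fixed_in_range: "l \<in> K.fixed \<Longrightarrow> \<kappa> l \<in> range \<Psi>"
proof -
  have "K.fixed \<subseteq> {u. \<kappa> u \<in> range \<Psi>}"
    unfolding fixed_eq
  proof (rule generate_field_subset)
    show "division_subring {u. \<kappa> u \<in> range \<Psi>}"
      by (rule division_subring_vimage[OF ring_hom_on_\<kappa> division_subring_range_\<Psi>])
    have "\<kappa> b \<in> range \<Psi>" if "b \<in> B" for b
      using B_cases[OF that] \<kappa>_y by (metis rangeI)
    then show "range ratfun_const \<union> B \<subseteq> {u. \<kappa> u \<in> range \<Psi>}"
      by (auto simp: \<kappa>_ratfun_const)
  qed
  then show "l \<in> K.fixed \<Longrightarrow> \<kappa> l \<in> range \<Psi>" by blast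
qed

lemma range_\<Psi>_invariant:
  assumes g: "g \<in> carrier G"
  shows "\<sigma> g (\<Psi> f) = \<Psi> f"
proof -
  have "\<sigma> g (\<Psi> w) = \<Psi> w" if "w \<in> W" for w
    using that
  proof (induction w rule: W_induct)
    case (mul p)
    have fixed: "division_subring {u. \<gamma> g u = u}"
      using division_subring_fixed_points[of "{g}" \<gamma>] \<gamma>[OF g] by simp
    note S = unital_subringD[OF fixed[unfolded division_subring_def, THEN conjunct1]]
    have "poly_eval ratfun_const y p \<in> {u. \<gamma> g u = u}"
    proof (induction p rule: mpoly_induct)
      case (Const c)
      show ?case by (simp add: poly_eval_Const ratfun_const_simps)
        (simp add: ratfun_const_def \<gamma>_to_fract[OF g] \<phi>_simps[OF g])
    next
      case (Var i)
      show ?case by (simp add: poly_eval_Var ratfun_const_simps B_fixed y_in_B g)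
    next
      case (add p q)
      then show ?case unfolding ring_hom_onD(2)[OF ring_hom_on_eval_y UNIV_I UNIV_I] by (rule S)
    next
      case (mult p q)
      then show ?case unfolding ring_hom_onD(3)[OF ring_hom_on_eval_y UNIV_I UNIV_I] by (rule S)
    qed
    then show ?case by (simp add: \<Psi>_mul \<tau>_def \<sigma>_\<kappa>[OF g])
  next
    case (der i)
    show ?case by (simp add: \<Psi>_der \<sigma>_\<Delta>[OF g])
  qed (simp_all add: \<Psi>_simps ring_hom_onD[OF \<sigma>[OF g]])
  then have "(\<lambda>f. \<sigma> g (\<Psi> f)) = \<Psi>"
    by (intro ring_hom_eqI[OF ring_hom_on_compose[OF \<sigma>[OF g] ring_hom_on_\<Psi>] ring_hom_on_\<Psi>]) simp
  then show ?thesis by (rule fun_cong)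
qed

section \<open>Finite dimension of the skew field over the range of \<open>\<Psi>\<close>\<close>

definition E :: "('n, 'k) ratfun set" where
  "E = (SOME E. finite E \<and> (\<forall>u. \<exists>c. (\<forall>e. c e \<in> K.fixed) \<and> u = (\<Sum>e\<in>E. c e * e)))"

lemma finite_E: "finite E" and E_spans: "\<exists>c. (\<forall>e. c e \<in> K.fixed) \<and> u = (\<Sum>e\<in>E. c e * e)"
  using someI_ex[OF K.finite_spanning_set] unfolding E_def by blast+

text \<open>Coefficients from \<open>range \<Psi>\<close> stand on the right, which leaves the left
  side free for multiplication by the Weyl algebra.\<close>

definition span :: "'f set" where
  "span = {\<Sum>e\<in>E. \<kappa> e * \<Psi> (f e) | f. True}"

lemma span_add:
  assumes "a \<in> span" and "b \<in> span"
  shows "a + b \<in> span"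
proof -
  obtain f h where "a = (\<Sum>e\<in>E. \<kappa> e * \<Psi> (f e))" "b = (\<Sum>e\<in>E. \<kappa> e * \<Psi> (h e))"
    using assms unfolding span_def by blast
  then have "a + b = (\<Sum>e\<in>E. \<kappa> e * \<Psi> (f e + h e))"
    by (simp add: \<Psi>_simps distrib_left sum.distrib)
  then show ?thesis unfolding span_def by (intro CollectI exI[of _ "\<lambda>e. f e + h e"]) simp
qed

lemma span_mult_right:
  assumes "a \<in> span"
  shows "a * \<Psi> h \<in> span"
proof -
  obtain f where "a = (\<Sum>e\<in>E. \<kappa> e * \<Psi> (f e))" using assms unfolding span_def by blast
  then have "a * \<Psi> h = (\<Sum>e\<in>E. \<kappa> e * \<Psi> (f e * h))"
    by (simp add: \<Psi>_simps sum_distrib_right mult.assoc)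
  then show ?thesis unfolding span_def by (intro CollectI exI[of _ "\<lambda>e. f e * h"]) simp
qed

text \<open>The invariant coefficients of \<open>u\<close> commute with \<open>e\<close> inside the
  field of rational functions and lie in \<open>range \<Psi>\<close> after
  \<open>\<kappa>\<close>.\<close>

lemma \<kappa>_in_span: "\<kappa> u \<in> span"
proof -
  obtain c where c: "\<And>e. c e \<in> K.fixed" and u: "u = (\<Sum>e\<in>E. c e * e)" using E_spans by blast
  have "\<exists>f. \<kappa> (c e) = \<Psi> f" for e using \<kappa>_fixed_in_range[OF c] by blast
  then obtain f where f: "\<And>e. \<kappa> (c e) = \<Psi> (f e)" by metis
  have "\<kappa> u = (\<Sum>e\<in>E. \<kappa> e * \<kappa> (c e))" unfolding u by (simp add: \<kappa>_simps \<kappa>_commute)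
  then show ?thesis unfolding f span_def by (intro CollectI exI[of _ f]) simp
qed

lemma span_zero: "0 \<in> span"
  using \<kappa>_in_span[of 0] by (simp add: \<kappa>_simps)

lemma span_sum: "(\<And>i. i \<in> A \<Longrightarrow> f i \<in> span) \<Longrightarrow> sum f A \<in> span"
  by (induction A rule: infinite_finite_induct) (simp_all add: span_zero span_add)

lemma span_induct [consumes 1, case_names base add]:
  assumes "a \<in> span" and "\<And>u f. Q (\<kappa> u * \<Psi> f)" and "\<And>a b. Q a \<Longrightarrow> Q b \<Longrightarrow> Q (a + b)"
  shows "Q a"
proof -
  have "Q (\<Sum>e\<in>A. \<kappa> e * \<Psi> (f e))" if "finite A" for A f
    using that
  proof induction
    case empty
    show ?case using assms(2)[of 0] by (simp add: \<kappa>_simps)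
  qed (simp add: assms)
  with assms(1) finite_E show ?thesis unfolding span_def by blast
qed

lemma span_\<kappa>_mult: "a \<in> span \<Longrightarrow> \<kappa> u * a \<in> span"
proof (induction a rule: span_induct)
  case (base v f)
  have "\<kappa> (u * v) * \<Psi> f \<in> span" by (intro span_mult_right \<kappa>_in_span)
  then show ?case by (simp add: \<kappa>_simps mult.assoc)
qed (simp add: distrib_left span_add)

text \<open>\<open>\<Delta> i\<close> passes \<open>\<kappa> v\<close> at the cost of
  \<open>\<kappa> (\<delta> i v)\<close> and is then absorbed by the coefficient, being
  \<open>\<Psi> (der i)\<close>.\<close>

lemma span_\<Delta>_mult: "a \<in> span \<Longrightarrow> \<Delta> i * a \<in> span"
proof (induction a rule: span_induct)
  case (base v f)
  have "\<kappa> v * \<Psi> (der i * f) + \<kappa> (\<delta> i v) * \<Psi> f \<in> span"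
    by (intro span_add span_mult_right \<kappa>_in_span)
  also have "\<kappa> v * \<Psi> (der i * f) + \<kappa> (\<delta> i v) * \<Psi> f = \<Delta> i * (\<kappa> v * \<Psi> f)"
    by (simp add: \<Psi>_simps \<Psi>_der \<Delta>_\<kappa> distrib_right flip: mult.assoc)
  finally show ?case .
qed (simp add: distrib_left span_add)

text \<open>For \<open>der j\<close> the expansion \<open>der_eq\<close> leaves only multiplications
  by \<open>\<kappa>\<close> and \<open>\<Delta> i\<close>.\<close>

lemma span_W_mult:
  assumes "w \<in> W" and "a \<in> span"
  shows "w * a \<in> span"
  using assms
proof (induction w arbitrary: a rule: W_induct)
  case (mul p)
  then show ?case using span_\<kappa>_mult[of a "to_fract p"] by (simp add: \<kappa>_to_fract)
next
  case (der j)
  have "(\<Sum>i\<in>UNIV. \<kappa> (D j (y i)) * (\<Delta> i * a)) \<in> span"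
    by (intro span_sum span_\<kappa>_mult span_\<Delta>_mult der)
  then show ?case by (simp add: der_eq[of j] sum_distrib_right mult.assoc)
qed (simp_all add: distrib_right span_add mult.assoc)

lemma W_subset_span: "w \<in> W \<Longrightarrow> w \<in> span"
  using span_W_mult[of w 1] \<kappa>_in_span[of 1] by (simp add: \<kappa>_simps)

text \<open>Since \<^const>\<open>span\<close> has finite dimension over \<^term>\<open>range \<Psi>\<close>, the powers of \<open>b\<close> satisfy a linear
  relation; cancelling the lowest power of \<open>b\<close> in it exhibits the inverse of \<open>b\<close>.\<close>

lemma inverse_in_span:
  assumes b: "b \<in> W" "b \<noteq> 0"
  shows "inverse b \<in> span"
proof -
  have power_W: "b ^ i \<in> W" for i
    by (induction i) (use b closed in auto)
  have "\<exists>f. b ^ i = (\<Sum>e\<in>E. \<kappa> e * \<Psi> (f e))" for i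
    using W_subset_span[OF power_W, of i] unfolding span_def by blast
  then obtain h where h: "\<And>i. b ^ i = (\<Sum>e\<in>E. \<kappa> e * \<Psi> (h i e))" by metis
  let ?N = "card E"
  \<comment> \<open>The \<open>card E + 1\<close> powers of \<open>b\<close> have
    \<open>card E\<close> coordinates each.\<close>
  obtain c where nz: "\<exists>i\<in>{..?N}. c i \<noteq> 0" and rel: "\<And>e. e \<in> E \<Longrightarrow> (\<Sum>i\<le>?N. h i e * c i) = 0"
    using homogeneous_system_nontrivial_solution[OF finite_E, of "{..?N}" "\<lambda>e i. h i e"] by auto
  have "(\<Sum>i\<le>?N. b ^ i * \<Psi> (c i)) = (\<Sum>e\<in>E. \<kappa> e * \<Psi> (\<Sum>i\<le>?N. h i e * c i))"
    unfolding h sum_distrib_right \<Psi>_simps sum_distrib_left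
    by (subst sum.swap) (simp add: mult.assoc)
  then have zero: "(\<Sum>i\<le>?N. b ^ i * \<Psi> (c i)) = 0" by (simp add: rel \<Psi>_simps)
  define m where "m = (LEAST i. c i \<noteq> 0)"
  have cm: "c m \<noteq> 0" using nz LeastI[of "\<lambda>i. c i \<noteq> 0"] by (auto simp: m_def)
  have below: "c i = 0" if "i < m" for i
    using that not_less_Least[of i "\<lambda>i. c i \<noteq> 0"] by (auto simp: m_def)
  have m: "m \<le> ?N" using nz Least_le[of "\<lambda>i. c i \<noteq> 0"] by (fastforce simp: m_def)
  \<comment> \<open>The terms above the lowest one, with \<open>b ^ Suc m\<close> cancelled on the
    left; the relation becomes \<open>b ^ m * (\<Psi> (c m) + b * s) = 0\<close>.\<close>
  define s where "s = (\<Sum>i\<in>{m<..?N}. b ^ (i - Suc m) * \<Psi> (c i))"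
  have "(\<Sum>i\<le>?N. b ^ i * \<Psi> (c i)) = (\<Sum>i\<in>{m..?N}. b ^ i * \<Psi> (c i))"
    by (rule sum.mono_neutral_right) (use below in \<open>auto simp: \<Psi>_simps\<close>)
  also have "{m..?N} = insert m {m<..?N}" using m by auto
  also have "(\<Sum>i\<in>\<dots>. b ^ i * \<Psi> (c i)) = b ^ m * \<Psi> (c m) + (\<Sum>i\<in>{m<..?N}. b ^ i * \<Psi> (c i))"
    by simp
  also have "(\<Sum>i\<in>{m<..?N}. b ^ i * \<Psi> (c i)) = b ^ m * (b * s)"
    unfolding s_def sum_distrib_left
  proof (rule sum.cong)
    fix i assume "i \<in> {m<..?N}"
    then have "b ^ i = b ^ (m + (1 + (i - Suc m)))" by (intro arg_cong[of _ _ "\<lambda>n. b ^ n"]) auto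
    then show "b ^ i * \<Psi> (c i) = b ^ m * (b * (b ^ (i - Suc m) * \<Psi> (c i)))"
      by (simp only: power_add power_one_right mult.assoc)
  qed simp
  finally have "b ^ m * (\<Psi> (c m) + b * s) = 0" using zero by (simp add: distrib_left)
  then have bs: "b * s = - \<Psi> (c m)" using b by (simp add: add_eq_0_iff)
  have nz: "\<Psi> (c m) \<noteq> 0" by (rule ring_hom_nonzero[OF ring_hom_on_\<Psi> cm])
  have inv: "inverse b = s * \<Psi> (- inverse (c m))"
  proof -
    have "b * (s * \<Psi> (- inverse (c m))) = - \<Psi> (c m) * - inverse (\<Psi> (c m))"
      using \<Psi>_simps(5)[of 0 "inverse (c m)"]
      by (simp add: \<Psi>_simps ring_hom_inverse[OF ring_hom_on_\<Psi>] bs flip: mult.assoc)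
    then have "b * (s * \<Psi> (- inverse (c m))) = 1" using nz by simp
    then show ?thesis by (rule inverse_unique)
  qed
  have "s \<in> span"
    unfolding s_def by (intro span_sum span_mult_right W_subset_span power_W)
  then show ?thesis unfolding inv by (rule span_mult_right)
qed

lemma span_eq_UNIV: "f \<in> span"
proof -
  obtain a b where "a \<in> W" "b \<in> W" "b \<noteq> 0" "f = a * inverse b" using fraction by blast
  then show ?thesis by (simp add: span_W_mult inverse_in_span)
qed

text \<open>Summing the conjugates of an expansion of \<open>f\<close> leaves the invariant
  coefficients \<open>\<Psi> (h e)\<close> alone and turns each \<open>e\<close> into its trace. The
  trace is an invariant function, so \<open>\<kappa>\<close> sends it into
  \<open>range \<Psi>\<close>.\<close>

lemma invariant_in_range:
  assumes "\<And>g. g \<in> carrier G \<Longrightarrow> \<sigma> g f = f"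
  shows "f \<in> range \<Psi>"
proof -
  let ?N = "of_nat (card (carrier G)) :: 'f"
  obtain h where f: "f = (\<Sum>e\<in>E. \<kappa> e * \<Psi> (h e))" using span_eq_UNIV unfolding span_def by blast
  have "?N * f = (\<Sum>g\<in>carrier G. \<sigma> g f)" by (simp add: assms)
  also have "\<dots> = (\<Sum>g\<in>carrier G. \<Sum>e\<in>E. \<kappa> (\<gamma> g e) * \<Psi> (h e))"
    by (rule sum.cong) (simp_all add: f ring_hom_on_sum[OF \<sigma>] ring_hom_onD[OF \<sigma>] \<sigma>_\<kappa> range_\<Psi>_invariant)
  also have "\<dots> = (\<Sum>e\<in>E. \<kappa> (K.trace e) * \<Psi> (h e))"
    by (subst sum.swap) (simp add: K.trace_def \<kappa>_simps sum_distrib_right)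
  also have "\<dots> \<in> range \<Psi>"
    by (intro unital_subring_sum division_subring_range_\<Psi>[unfolded division_subring_def, THEN conjunct1]
        range_\<Psi>_closed(6) \<kappa>_fixed_in_range K.trace_fixed rangeI)
  finally have 1: "?N * f \<in> range \<Psi>" .
  \<comment> \<open>The type \<open>'f\<close> is only known to be a division ring; characteristic
    zero is carried over from the rational functions by \<open>\<kappa>\<close>.\<close>
  have N: "?N \<noteq> 0"
  proof -
    have "\<kappa> (of_nat n) = of_nat n" for n by (induction n) (simp_all add: \<kappa>_simps)
    moreover have "card (carrier G) \<noteq> 0" using finite_G by auto
    ultimately show ?thesis
      using ring_hom_nonzero[OF ring_hom_on_\<kappa>, of "of_nat (card (carrier G))"] by simp
  qed
  have "?N \<in> range \<Psi>"
    by (rule unital_subring_of_nat[OF division_subring_range_\<Psi>[unfolded division_subring_def, THEN conjunct1]])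
  then have "inverse ?N \<in> range \<Psi>"
    using division_subring_range_\<Psi> unfolding division_subring_def by blast
  from range_\<Psi>_closed(6)[OF this 1] show ?thesis using N by (simp flip: mult.assoc)
qed

section \<open>The isomorphism with the invariants\<close>

lemma invariants_eq_range: "weyl_field_invariants G \<phi> \<iota> = range \<Psi>"
  using invariant_in_range range_\<Psi>_invariant
  by (auto simp: weyl_field_invariants_def simp flip: \<sigma>_def)

lemma \<Psi>_weyl_const: "\<Psi> (weyl_const \<iota> c) = weyl_const \<iota> c"
proof -
  have "weyl_const \<iota> c = mul (Const c)" by (simp add: weyl_const_def mul_def)
  then show ?thesis using \<kappa>_to_fract[of "Const c"] by (simp add: ratfun_const_def flip: \<kappa>_ratfun_const)
qed

lemma algebras_isomorphic_invariants:
  "algebras_isomorphic (weyl_const \<iota>) (weyl_field_invariants G \<phi> \<iota>) (weyl_const \<iota>) UNIV"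
proof -
  let ?h = "inv_into UNIV \<Psi>"
  have inj: "inj \<Psi>" by (rule ring_hom_inj[OF ring_hom_on_\<Psi>])
  have h: "?h (\<Psi> f) = f" for f using inj by simp
  have "bij_betw ?h (range \<Psi>) UNIV"
    using inj by (intro bij_betw_inv_into inj_on_imp_bij_betw)
  moreover have "?h (u + v) = ?h u + ?h v \<and> ?h (u * v) = ?h u * ?h v"
    if "u \<in> range \<Psi>" "v \<in> range \<Psi>" for u v
    using that by (auto simp: h simp flip: \<Psi>_simps)
  moreover have "?h (weyl_const \<iota> c) = weyl_const \<iota> c" for c
    using h[of "weyl_const \<iota> c"] by (simp add: \<Psi>_weyl_const)
  ultimately show ?thesis
    unfolding algebras_isomorphic_def invariants_eq_range by (intro exI[of _ ?h]) blast
qed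

end

theorem theorem1p1:
  fixes G :: "('g, 'm) monoid_scheme"
    and \<phi> :: "'g \<Rightarrow> ('n::{finite,linorder}, 'k::field_char_0) mpoly \<Rightarrow> ('n, 'k) mpoly"
    and \<iota> :: "('n, 'k) operator \<Rightarrow> 'f::division_ring"
  assumes "finite (carrier G)"
    and "linear_action G \<phi>"
    and "weyl_skew_field \<iota>"
    and "purely_transcendental ratfun_const (ratfun_invariants G \<phi>)"
  shows "algebras_isomorphic
           (weyl_const \<iota>) (weyl_field_invariants G \<phi> \<iota>)
           (weyl_const \<iota>) (UNIV :: 'f set)"
proof -
  obtain B where "algebraically_independent ratfun_const B"
    and "ratfun_invariants G \<phi> = generate_field ring_of_type_algebra (range ratfun_const \<union> B)"
    using assms(4) unfolding purely_transcendental_def by blast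
  with assms have "noether_problem \<iota> G \<phi> B"
    by (intro noether_problem.intro weyl_fractions.intro noether_problem_axioms.intro)
      (auto simp only: linear_action_def)
  then show ?thesis by (rule noether_problem.algebras_isomorphic_invariants)
qed

end
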